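(* The assignment $\mathcal{S}_{\to}\colon\mathbf{roMDP}\to\mathbb{S}_{\to}$, identity on objects and sending a rightward open MDP $\mathcal A\colon m\to n$ to $\mathcal{S}_{\to}(\mathcal A)=\{\mathcal{S}^{\mathrm{MC}}_{\to}(\mathcal A_\tau)\mid\tau\colon Q^{\mathcal A}\to A\text{ a memoryless scheduler}\}$, is a traced symmetric monoidal functor; in particular $\mathcal{S}_{\to}(\mathcal A;\mathcal B)=\mathcal{S}_{\to}(\mathcal A);\mathcal{S}_{\to}(\mathcal B)$, $\mathcal{S}_{\to}(\mathcal A\oplus\mathcal B)=\mathcal{S}_{\to}(\mathcal A)\oplus\mathcal{S}_{\to}(\mathcal B)$ and $\mathcal{S}_{\to}(\mathrm{tr}^l_{m,n}(\mathcal E))=\mathrm{tr}^l_{m,n}(\mathcal{S}_{\to}(\mathcal E))$ for roMDPs of appropriate types.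
   Context: Notation: $[k]=\{1,\dots,k\}$, $[a,b]=\{a,\dots,b\}$, $+$ disjoint union; fix a nonempty finite action set $A$. An roMDP $\mathcal A\colon m\to n$ is $(m,n,Q,A,E,P,R)$: $Q$ finite positions; $E\colon[m]\to Q+[n]$; $P\colon Q\times A\times(Q+[n])\to\mathbb R_{\ge0}$, $\sum_{s'}P(s,a,s')\in\{0,1\}$; $R\colon Q\to\mathbb R_{\ge0}$; unique access: distinct elements of $[m]+Q$ reach disjoint sets of exits in one step ($i\in[m]$ reaches $E(i)$ if it is an exit; $s\in Q$ reaches exits $t$ with $P(s,a,t)>0$ for some $a$), and $P(s,a,t)>0$, $P(s,b,t)>0$ for an exit $t$ imply $a=b$. $\mathbf{roMDP}$: objects natural numbers, arrows isomorphism classes (bijections of positions preserving $E,P,R$). Operations: sequential composition $\mathcal A;\mathcal B$ ($\mathcal A\colon m\to k$, $\mathcal B\colon k\to n$): positions $Q^{\mathcal A}+Q^{\mathcal B}$; $E(i)=E^{\mathcal A}(i)$ if a position else $E^{\mathcal B}(E^{\mathcal A}(i))$; from $s\in Q^{\mathcal A}$: $P(s,a,s')=P^{\mathcal A}(s,a,s')$ for $s'\in Q^{\mathcal A}$, $\sum_{i\in[k]}P^{\mathcal A}(s,a,i)[E^{\mathcal B}(i)=s']$ for $s'\in Q^{\mathcal B}+[n]$; from $s\in Q^{\mathcal B}$: $P^{\mathcal B}$ into $Q^{\mathcal B}+[n]$, $0$ otherwise; rewards by cases. Sum $\oplus$: disjoint juxtaposition with the second component's entrances/exits shifted. Trace $\mathrm{tr}^l_{m,n}(\mathcal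 E)$, $\mathcal E\colon l+m\to l+n$: positions $Q^{\mathcal E}$, rewards $R^{\mathcal E}$, exits in $[l]$ fed back to entrances in $[l]$; $E(i)$: follow $i+l,E^{\mathcal E}(i+l),\dots$ until first element $t\in[l+1,l+n]+Q^{\mathcal E}$, giving $t-l$ if exit else $t$; $P(q,a,q')=P^{\mathcal E}(q,a,q'+l)+\sum_{i\in\mathrm{prec}(q'+l)}P^{\mathcal E}(q,a,i)$ for $q'\in[n]$ and $P^{\mathcal E}(q,a,q')+\sum_{i\in\mathrm{prec}(q')}P^{\mathcal E}(q,a,i)$ for $q'\in Q^{\mathcal E}$, where $\mathrm{prec}(t)$ = set of $i\in[l]$ whose chain $i,E^{\mathcal E}(i),\dots$ stays in $[l]$ until reaching $t$. Identities and swaps are positionless wirings. Induced chain: for $\tau\colon Q^{\mathcal A}\to A$, $\mathcal A_\tau$ has the same data with single action $\star$ and $P(s,\star,t)=P^{\mathcal A}(s,\tau(s),t)$. For a chain, a path from entrance $i$ to exit $j$ is $i,s_1,\dots,s_k,j$ with first element after $i$ equal to $E(i)$; probability $\prod_tP(s_t,\star,s_{t+1})$ ($s_{k+1}=j$), reward $\sum_tR(s_t)$; $\mathrm{RPr}_{i,j}$ = total probability, $\mathrm{ERw}_{i,j}$ = sum of probability times reward over paths from $i$ to $j$. $\mathcal{S}^{\mathrm{MC}}_{\to}(\mathcal C)(i,j)=(\mathrm{RPr}^{\mathcal C}_{i,j},\mathrm{ERw}^{\mathcal C}_{i,j})$. $\mathbb{S}^{\mathrm{MC}}_{\to}$: objects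 naturals; arrows $f\colon m\to n$ assign pairs $(p_{i,j},r_{i,j})\in\mathbb R^2_{\ge0}$ with $\sum_jp_{i,j}\le1$ and $p_{i,j}=0\Rightarrow r_{i,j}=0$; $P^{f;g}=P^fP^g$, $R^{f;g}=P^fR^g+R^fP^g$; $\oplus$ block diagonal; identity $(\delta_{ij},0)$; swap $m+n\to n+m$ with $(1,0)$ at $(i,i+n)$ for $i\le m$ and $(i,i-m)$ for $i>m$; trace of $h\colon l+m\to l+n$: $p^{\mathrm{tr}(h)}_{i,j}=p^h_{l+i,l+j}+\sum_d(A_pB_p^dC_p)_{i,j}$, $r^{\mathrm{tr}(h)}_{i,j}=r^h_{l+i,l+j}+\sum_d(AB^dC)_{i,j}$ with $A_p=[p^h_{l+i,k}]$, $B_p=[p^h_{k,k'}]$, $C_p=[p^h_{k',l+j}]$ ($k,k'\in[l]$), $A_r,B_r,C_r$ likewise with $r^h$, $A=(A_p\ A_r)$, $B=\begin{pmatrix}B_p&B_r\\0&B_p\end{pmatrix}$, $C=\begin{pmatrix}C_r\\C_p\end{pmatrix}$. $\mathbb{S}_{\to}$: objects naturals, arrows $m\to n$ are sets of arrows $m\to n$ of $\mathbb{S}^{\mathrm{MC}}_{\to}$, with $;,\oplus,\mathrm{tr}$ applied elementwise and identities/swaps the corresponding singletons. *)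

theory Defs
  imports "HOL-Analysis.Infinite_Sum" "Jordan_Normal_Form.Matrix"
begin

text \<open>
  The set \<open>[k]\<close> is rendered as \<open>{..<k}\<close>, so entrances, exits and matrix indices count from 0.
  The fixed nonempty finite action set is a type of class \<open>finite\<close>. An element of \<open>Q + [n]\<close> is
  \<open>Inl s\<close> for a position \<open>s\<close> and \<open>Inr j\<close> for an exit \<open>j\<close>.
\<close>

section \<open>Rightward open MDPs\<close>

record ('q, 'a) romdp =
  ins :: nat
  outs :: nat
  positions :: "'q set"
  entry :: "nat \<Rightarrow> 'q + nat"
  tprob :: "'q \<Rightarrow> 'a \<Rightarrow> 'q + nat \<Rightarrow> real"
  reward :: "'q \<Rightarrow> real"

definition targets :: "('q, 'a) romdp \<Rightarrow> ('q + nat) set" where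
  "targets A = positions A <+> {..<outs A}"

text \<open>The exits reached in one step from an element of \<open>[m] + Q\<close>.\<close>

fun reached_exits :: "('q, 'a) romdp \<Rightarrow> nat + 'q \<Rightarrow> nat set" where
  "reached_exits A (Inl i) = {j. j < outs A \<and> entry A i = Inr j}"
| "reached_exits A (Inr s) = {j. j < outs A \<and> (\<exists>a. tprob A s a (Inr j) > 0)}"

definition unique_access :: "('q, 'a) romdp \<Rightarrow> bool" where
  "unique_access A \<longleftrightarrow>
     (\<forall>x\<in>{..<ins A} <+> positions A. \<forall>y\<in>{..<ins A} <+> positions A.
        x \<noteq> y \<longrightarrow> reached_exits A x \<inter> reached_exits A y = {}) \<and>
     (\<forall>s\<in>positions A. \<forall>a b. \<forall>j<outs A.
        tprob A s a (Inr j) > 0 \<and> tprob A s b (Inr j) > 0 \<longrightarrow> a = b)"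

definition is_romdp :: "nat \<Rightarrow> nat \<Rightarrow> ('q, 'a) romdp \<Rightarrow> bool" where
  "is_romdp m n A \<longleftrightarrow>
     ins A = m \<and> outs A = n \<and> finite (positions A) \<and>
     (\<forall>i<m. entry A i \<in> targets A) \<and>
     (\<forall>s\<in>positions A. \<forall>a. \<forall>t\<in>targets A. tprob A s a t \<ge> 0) \<and>
     (\<forall>s\<in>positions A. \<forall>a. (\<Sum>t\<in>targets A. tprob A s a t) \<in> {0, 1}) \<and>
     (\<forall>s\<in>positions A. reward A s \<ge> 0) \<and>
     unique_access A"

definition romdp_iso :: "('q, 'a) romdp \<Rightarrow> ('r, 'a) romdp \<Rightarrow> bool" where
  "romdp_iso A B \<longleftrightarrow>
     ins A = ins B \<and> outs A = outs B \<and>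
     (\<exists>f. bij_betw f (positions A) (positions B) \<and>
        (\<forall>i<ins A. entry B i = map_sum f id (entry A i)) \<and>
        (\<forall>s\<in>positions A. \<forall>a. \<forall>t\<in>targets A.
           tprob B (f s) a (map_sum f id t) = tprob A s a t) \<and>
        (\<forall>s\<in>positions A. reward B (f s) = reward A s))"


subsection \<open>Operations\<close>

definition romdp_id :: "nat \<Rightarrow> ('q, 'a) romdp" where
  "romdp_id n =
     \<lparr>ins = n, outs = n, positions = {}, entry = Inr, tprob = (\<lambda>_ _ _. 0), reward = (\<lambda>_. 0)\<rparr>"

definition romdp_swap :: "nat \<Rightarrow> nat \<Rightarrow> ('q, 'a) romdp" where
  "romdp_swap m n =
     \<lparr>ins = m + n, outs = n + m, positions = {},
      entry = (\<lambda>i. if i < m then Inr (i + n) else Inr (i - m)),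
      tprob = (\<lambda>_ _ _. 0), reward = (\<lambda>_. 0)\<rparr>"

definition romdp_comp :: "('q, 'a) romdp \<Rightarrow> ('r, 'a) romdp \<Rightarrow> ('q + 'r, 'a) romdp" where
  "romdp_comp A B =
     \<lparr>ins = ins A, outs = outs B, positions = positions A <+> positions B,
      entry = (\<lambda>i. case entry A i of
          Inl s \<Rightarrow> Inl (Inl s)
        | Inr k \<Rightarrow> map_sum Inr id (entry B k)),
      tprob = (\<lambda>x a t. case x of
          Inl s \<Rightarrow> (case t of
              Inl (Inl s') \<Rightarrow> tprob A s a (Inl s')
            | Inl (Inr s') \<Rightarrow> (\<Sum>i<outs A. tprob A s a (Inr i) * of_bool (entry B i = Inl s'))
            | Inr j \<Rightarrow> (\<Sum>i<outs A. tprob A s a (Inr i) * of_bool (entry B i = Inr j)))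
        | Inr s \<Rightarrow> (case t of
              Inl (Inl _) \<Rightarrow> 0
            | Inl (Inr s') \<Rightarrow> tprob B s a (Inl s')
            | Inr j \<Rightarrow> tprob B s a (Inr j))),
      reward = case_sum (reward A) (reward B)\<rparr>"

definition romdp_sum :: "('q, 'a) romdp \<Rightarrow> ('r, 'a) romdp \<Rightarrow> ('q + 'r, 'a) romdp" where
  "romdp_sum A B =
     \<lparr>ins = ins A + ins B, outs = outs A + outs B, positions = positions A <+> positions B,
      entry = (\<lambda>i. if i < ins A then map_sum Inl id (entry A i)
                   else map_sum Inr (\<lambda>j. j + outs A) (entry B (i - ins A))),
      tprob = (\<lambda>x a t. case x of
          Inl s \<Rightarrow> (case t of
              Inl (Inl s') \<Rightarrow> tprob A s a (Inl s')
            | Inl (Inr _) \<Rightarrow> 0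
            | Inr j \<Rightarrow> (if j < outs A then tprob A s a (Inr j) else 0))
        | Inr s \<Rightarrow> (case t of
              Inl (Inl _) \<Rightarrow> 0
            | Inl (Inr s') \<Rightarrow> tprob B s a (Inl s')
            | Inr j \<Rightarrow> (if j < outs A then 0 else tprob B s a (Inr (j - outs A))))),
      reward = case_sum (reward A) (reward B)\<rparr>"

text \<open>
  \<open>leads_to l e i t\<close>: starting at entrance \<open>i\<close> and feeding each exit in \<open>[l]\<close> back to the entrance
  of the same number, \<open>t\<close> is the first element reached that is not an exit in \<open>[l]\<close>.
\<close>

inductive leads_to :: "nat \<Rightarrow> (nat \<Rightarrow> 'q + nat) \<Rightarrow> nat \<Rightarrow> 'q + nat \<Rightarrow> bool"
  for l :: nat and e :: "nat \<Rightarrow> 'q + nat" where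
  stop: "e i \<notin> Inr ` {..<l} \<Longrightarrow> leads_to l e i (e i)"
| step: "e i = Inr j \<Longrightarrow> j < l \<Longrightarrow> leads_to l e j t \<Longrightarrow> leads_to l e i t"

definition prec :: "nat \<Rightarrow> ('q, 'a) romdp \<Rightarrow> 'q + nat \<Rightarrow> nat set" where
  "prec l E t = {i. i < l \<and> leads_to l (entry E) i t}"

text \<open>
  The chain of the entrance \<open>i + l\<close> always stops: by unique access no exit is reached from two
  entrances, so a chain starting outside \<open>[l]\<close> never runs into a cycle.
\<close>

definition romdp_trace :: "nat \<Rightarrow> nat \<Rightarrow> nat \<Rightarrow> ('q, 'a) romdp \<Rightarrow> ('q, 'a) romdp" where
  "romdp_trace l m n E =
     \<lparr>ins = m, outs = n, positions = positions E,
      entry = (\<lambda>i. map_sum id (\<lambda>t. t - l) (THE t. leads_to l (entry E) (i + l) t)),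
      tprob = (\<lambda>q a t. case t of
          Inl q' \<Rightarrow> tprob E q a (Inl q') + (\<Sum>i\<in>prec l E (Inl q'). tprob E q a (Inr i))
        | Inr j \<Rightarrow> tprob E q a (Inr (j + l)) + (\<Sum>i\<in>prec l E (Inr (j + l)). tprob E q a (Inr i))),
      reward = reward E\<rparr>"


section \<open>Strict traced symmetric monoidal structure on the natural numbers\<close>

text \<open>
  The objects are the natural numbers, with addition as tensor and 0 as unit; associators and
  unitors are identities. Hence a strict functor that is the identity on objects preserves the
  tensor of objects, the unit and these coherence maps automatically.
\<close>

record 'f tsm_structure =
  arrows :: "nat \<Rightarrow> nat \<Rightarrow> 'f set"
  ident :: "nat \<Rightarrow> 'f"
  seq :: "'f \<Rightarrow> 'f \<Rightarrow> 'f"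
  tensor :: "'f \<Rightarrow> 'f \<Rightarrow> 'f"
  symm :: "nat \<Rightarrow> nat \<Rightarrow> 'f"
  trc :: "nat \<Rightarrow> nat \<Rightarrow> nat \<Rightarrow> 'f \<Rightarrow> 'f"

definition traced_symmetric_monoidal_functor ::
  "'f tsm_structure \<Rightarrow> 'g tsm_structure \<Rightarrow> ('f \<Rightarrow> 'g) \<Rightarrow> bool" where
  "traced_symmetric_monoidal_functor C D F \<longleftrightarrow>
     (\<forall>m n. \<forall>f\<in>arrows C m n. F f \<in> arrows D m n) \<and>
     (\<forall>n. F (ident C n) = ident D n) \<and>
     (\<forall>m k n. \<forall>f\<in>arrows C m k. \<forall>g\<in>arrows C k n. F (seq C f g) = seq D (F f) (F g)) \<and>
     (\<forall>m n m' n'. \<forall>f\<in>arrows C m n. \<forall>g\<in>arrows C m' n'.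
        F (tensor C f g) = tensor D (F f) (F g)) \<and>
     (\<forall>m n. F (symm C m n) = symm D m n) \<and>
     (\<forall>l m n. \<forall>h\<in>arrows C (l + m) (l + n). F (trc C l m n h) = trc D l m n (F h))"

text \<open>
  An isomorphism class is represented by its members whose positions are natural numbers; since
  position sets are finite, every class has such members. The operations are lifted to classes
  through representatives.
\<close>

definition iso_class :: "('q, 'a) romdp \<Rightarrow> (nat, 'a) romdp set" where
  "iso_class A = {B. romdp_iso A B}"

definition roMDP :: "(nat, 'a) romdp set tsm_structure" where
  "roMDP =
     \<lparr>arrows = (\<lambda>m n. {iso_class A |A :: (nat, 'a) romdp. is_romdp m n A}),
      ident = (\<lambda>n. iso_class (romdp_id n :: (nat, 'a) romdp)),
      seq = (\<lambda>X Y. \<Union>A\<in>X. \<Union>B\<in>Y. iso_class (romdp_comp A B)),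
      tensor = (\<lambda>X Y. \<Union>A\<in>X. \<Union>B\<in>Y. iso_class (romdp_sum A B)),
      symm = (\<lambda>m n. iso_class (romdp_swap m n :: (nat, 'a) romdp)),
      trc = (\<lambda>l m n X. \<Union>E\<in>X. iso_class (romdp_trace l m n E))\<rparr>"


section \<open>The semantic category\<close>

text \<open>
  A family of pairs \<open>(p\<^sub>i\<^sub>j, r\<^sub>i\<^sub>j)\<close> is represented by the pair of matrices \<open>([p\<^sub>i\<^sub>j], [r\<^sub>i\<^sub>j])\<close>.
\<close>

type_synonym mc_arrow = "real mat \<times> real mat"

definition mc_arrows :: "nat \<Rightarrow> nat \<Rightarrow> mc_arrow set" where
  "mc_arrows m n =
     {(p, r). p \<in> carrier_mat m n \<and> r \<in> carrier_mat m n \<and>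
        (\<forall>i<m. \<forall>j<n. p $$ (i, j) \<ge> 0 \<and> r $$ (i, j) \<ge> 0) \<and>
        (\<forall>i<m. (\<Sum>j<n. p $$ (i, j)) \<le> 1) \<and>
        (\<forall>i<m. \<forall>j<n. p $$ (i, j) = 0 \<longrightarrow> r $$ (i, j) = 0)}"

definition mc_id :: "nat \<Rightarrow> mc_arrow" where
  "mc_id n = (1\<^sub>m n, 0\<^sub>m n n)"

definition mc_swap :: "nat \<Rightarrow> nat \<Rightarrow> mc_arrow" where
  "mc_swap m n =
     (mat (m + n) (n + m) (\<lambda>(i, j). of_bool (if i < m then j = i + n else j = i - m)),
      0\<^sub>m (m + n) (n + m))"

definition mc_comp :: "mc_arrow \<Rightarrow> mc_arrow \<Rightarrow> mc_arrow" where
  "mc_comp f g = (fst f * fst g, fst f * snd g + snd f * fst g)"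

definition block_diag :: "real mat \<Rightarrow> real mat \<Rightarrow> real mat" where
  "block_diag M N =
     four_block_mat M (0\<^sub>m (dim_row M) (dim_col N)) (0\<^sub>m (dim_row N) (dim_col M)) N"

definition mc_sum :: "mc_arrow \<Rightarrow> mc_arrow \<Rightarrow> mc_arrow" where
  "mc_sum f g = (block_diag (fst f) (fst g), block_diag (snd f) (snd g))"

text \<open>The row block matrix \<open>A = (A\<^sub>p A\<^sub>r)\<close> is a four-block matrix whose lower blocks have no rows.\<close>

definition mc_trace :: "nat \<Rightarrow> nat \<Rightarrow> nat \<Rightarrow> mc_arrow \<Rightarrow> mc_arrow" where
  "mc_trace l m n h =
     (let A_part = (\<lambda>M :: real mat. mat m l (\<lambda>(i, k). M $$ (l + i, k)));
          B_part = (\<lambda>M :: real mat. mat l l (\<lambda>(k, k'). M $$ (k, k')));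
          C_part = (\<lambda>M :: real mat. mat l n (\<lambda>(k, j). M $$ (k, l + j)));
          (p, r) = h;
          A = four_block_mat (A_part p) (A_part r) (0\<^sub>m 0 l) (0\<^sub>m 0 l);
          B = four_block_mat (B_part p) (B_part r) (0\<^sub>m l l) (B_part p);
          C = C_part r @\<^sub>r C_part p
      in (mat m n (\<lambda>(i, j). p $$ (l + i, l + j)
              + (\<Sum>d. (A_part p * (B_part p ^\<^sub>m d) * C_part p) $$ (i, j))),
          mat m n (\<lambda>(i, j). r $$ (l + i, l + j)
              + (\<Sum>d. (A * (B ^\<^sub>m d) * C) $$ (i, j)))))"

definition sem_cat :: "mc_arrow set tsm_structure" where
  "sem_cat =
     \<lparr>arrows = (\<lambda>m n. Pow (mc_arrows m n)),
      ident = (\<lambda>n. {mc_id n}),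
      seq = (\<lambda>F G. {mc_comp f g |f g. f \<in> F \<and> g \<in> G}),
      tensor = (\<lambda>F G. {mc_sum f g |f g. f \<in> F \<and> g \<in> G}),
      symm = (\<lambda>m n. {mc_swap m n}),
      trc = (\<lambda>l m n H. mc_trace l m n ` H)\<rparr>"


section \<open>The semantics\<close>

definition induced_chain :: "('q, 'a) romdp \<Rightarrow> ('q \<Rightarrow> 'a) \<Rightarrow> ('q, unit) romdp" where
  "induced_chain A \<tau> =
     \<lparr>ins = ins A, outs = outs A, positions = positions A, entry = entry A,
      tprob = (\<lambda>s _ t. tprob A s (\<tau> s) t), reward = reward A\<rparr>"

text \<open>
  The path \<open>i, s\<^sub>1, \<dots>, s\<^sub>k, j\<close> is represented by the list \<open>[s\<^sub>1, \<dots>, s\<^sub>k]\<close>, which is empty when the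
  entrance \<open>i\<close> is wired directly to the exit \<open>j\<close>.
\<close>

definition path_tail :: "'q list \<Rightarrow> nat \<Rightarrow> ('q + nat) list" where
  "path_tail ss j = map Inl ss @ [Inr j]"

definition paths :: "('q, unit) romdp \<Rightarrow> nat \<Rightarrow> nat \<Rightarrow> 'q list set" where
  "paths C i j = {ss. set ss \<subseteq> positions C \<and> hd (path_tail ss j) = entry C i}"

definition path_prob :: "('q, unit) romdp \<Rightarrow> 'q list \<Rightarrow> nat \<Rightarrow> real" where
  "path_prob C ss j = (\<Prod>t<length ss. tprob C (ss ! t) () (path_tail ss j ! Suc t))"

definition path_reward :: "('q, unit) romdp \<Rightarrow> 'q list \<Rightarrow> real" where
  "path_reward C ss = (\<Sum>s\<leftarrow>ss. reward C s)"

definition RPr :: "('q, unit) romdp \<Rightarrow> nat \<Rightarrow> nat \<Rightarrow> real" where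
  "RPr C i j = (\<Sum>\<^sub>\<infinity>ss\<in>paths C i j. path_prob C ss j)"

definition ERw :: "('q, unit) romdp \<Rightarrow> nat \<Rightarrow> nat \<Rightarrow> real" where
  "ERw C i j = (\<Sum>\<^sub>\<infinity>ss\<in>paths C i j. path_prob C ss j * path_reward C ss)"

definition mc_sem :: "('q, unit) romdp \<Rightarrow> mc_arrow" where
  "mc_sem C =
     (mat (ins C) (outs C) (\<lambda>(i, j). RPr C i j), mat (ins C) (outs C) (\<lambda>(i, j). ERw C i j))"

definition romdp_sem :: "('q, 'a) romdp \<Rightarrow> mc_arrow set" where
  "romdp_sem A = {mc_sem (induced_chain A \<tau>) |\<tau>. True}"

text \<open>
  The action on isomorphism classes. As \<^const>\<open>romdp_sem\<close> is invariant under isomorphism, the union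
  is the common value of \<^const>\<open>romdp_sem\<close> on all representatives.
\<close>

definition sem_functor :: "(nat, 'a) romdp set \<Rightarrow> mc_arrow set" where
  "sem_functor X = (\<Union>A\<in>X. romdp_sem A)"

end

theory Submission
  imports Defs
begin

text \<open>
  A pair \<open>(p, r)\<close> of a probability and an accumulated reward is the dual number \<open>p + r \<epsilon>\<close> with
  \<open>\<epsilon>\<^sup>2 = 0\<close>. A position \<open>s\<close> contributes \<open>1 + R(s) \<epsilon>\<close> to the weight of a path, so that the semantics
  of a chain is the sum of the path weights, and composition and trace of the semantic category are
  the usual ones of matrices over dual numbers. A sum of path weights is the least solution of a
  linear system with one unknown per position, and least solutions can be computed by eliminating
  the unknowns in any order. The trace is the instance in which the unknowns are the positions and
  the \<open>l\<close> fed back wires: eliminating the wires first gives the traced chain, eliminating the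
  positions first gives the trace of the semantics. Composition is similar, and schedulers of a
  compound MDP are pairs of schedulers of its parts. All sums are taken in \<open>ennreal\<close>; they are finite
  because a finite probability of reaching an exit already forces geometric decay.
\<close>

section \<open>Path sums with values in the extended nonnegative reals\<close>

text \<open>A chain may have positions from which no exit can be reached, for instance a self loop
  of probability 1. There the linear system of a path sum has many solutions, so path sums have to
  be handled as least solutions and not through an inverse matrix. Since \<open>ennreal\<close>
  offers no subtraction to work with, the central identities are obtained as two inequalities, each
  by showing that one side is a supersolution of a system whose least solution is the other. The
  reward entries stay finite because only paths ending in an exit count, and the weight of these
  decays geometrically with their length, even if the chain can stay forever among its positions.
  Doubling every node, instead of using dual numbers as coefficients, keeps all weights in
  \<open>ennreal\<close>: elimination is proved once for scalars and then yields the equations for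
  probabilities and rewards together.\<close>

definition path_step :: "'x set \<Rightarrow> ('x \<Rightarrow> 'x \<Rightarrow> ennreal) \<Rightarrow> ('x \<Rightarrow> ennreal) \<Rightarrow> 'x \<Rightarrow> ennreal" where
  "path_step X W v x = (\<Sum>y\<in>X. W x y * v y)"

text \<open>Only intermediate nodes range over \<open>X\<close>; the start \<open>x\<close> may lie
  outside. An entrance is such a start, and a node of the same kind becomes intermediate when a
  trace feeds it back.\<close>

definition path_sum :: "'x set \<Rightarrow> ('x \<Rightarrow> 'x \<Rightarrow> ennreal) \<Rightarrow> ('x \<Rightarrow> ennreal) \<Rightarrow> 'x \<Rightarrow> ennreal" where
  "path_sum X W c x = (\<Sum>n. (path_step X W ^^ n) c x)"

section \<open>Linearity, the fixed point equation and least solutions\<close>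

lemma suminf_ennreal_sum:
  fixes f :: "'i \<Rightarrow> nat \<Rightarrow> ennreal"
  shows "(\<Sum>n. \<Sum>i\<in>I. f i n) = (\<Sum>i\<in>I. \<Sum>n. f i n)"
  by (rule suminf_sum) auto

lemma suminf_ennreal_Suc:
  fixes f :: "nat \<Rightarrow> ennreal"
  shows "(\<Sum>n. f n) = f 0 + (\<Sum>n. f (Suc n))"
  using suminf_offset[of f 1] by (simp add: add.commute)

lemma path_step_suminf: "path_step X W (\<lambda>y. \<Sum>n. f n y) x = (\<Sum>n. path_step X W (f n) x)"
  by (simp add: path_step_def suminf_ennreal_sum)

lemma path_step_cong:
  "(\<And>y. y \<in> X \<Longrightarrow> W x y * v y = W' x y * v' y) \<Longrightarrow> path_step X W v x = path_step X W' v' x"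
  by (simp add: path_step_def)

lemma path_step_mono:
  "(\<And>y. y \<in> X \<Longrightarrow> u y \<le> v y) \<Longrightarrow> path_step X W u x \<le> path_step X W v x"
  by (auto simp: path_step_def intro!: sum_mono mult_left_mono)

lemma path_step_add: "path_step X W (\<lambda>y. u y + v y) x = path_step X W u x + path_step X W v x"
  by (simp add: path_step_def distrib_left sum.distrib)

lemma path_step_cmult: "path_step X W (\<lambda>y. a * v y) x = a * path_step X W v x"
  by (simp add: path_step_def sum_distrib_left mult.left_commute)

lemma path_step_sum: "path_step X W (\<lambda>y. \<Sum>i\<in>I. f i y) x = (\<Sum>i\<in>I. path_step X W (f i) x)"
  by (simp add: path_step_def sum_distrib_left sum.swap[of _ X])

lemma path_sum_empty [simp]: "path_sum {} W c x = c x"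
proof -
  have "(path_step {} W ^^ Suc n) c x = 0" for n
    by (simp add: path_step_def)
  then show ?thesis
    unfolding path_sum_def by (subst suminf_ennreal_Suc) simp
qed

text \<open>The right-hand side is a tail of the series. The case \<open>k = 1\<close> gives the
  fixed point equation, large \<open>k\<close> the decay on which finiteness of rewards
  rests.\<close>

lemma path_sum_funpow:
  "(path_step X W ^^ k) (path_sum X W c) x = (\<Sum>n. (path_step X W ^^ (n + k)) c x)"
proof (induction k arbitrary: x)
  case 0
  then show ?case by (simp add: path_sum_def)
next
  case (Suc k)
  then have "(path_step X W ^^ k) (path_sum X W c) = (\<lambda>x. \<Sum>n. (path_step X W ^^ (n + k)) c x)"
    by (intro ext)
  then show ?case by (simp add: path_step_suminf)
qed

lemma path_sum_unfold: "path_sum X W c x = c x + path_step X W (path_sum X W c) x"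
  using path_sum_funpow[of 1 X W c x]
  by (simp add: path_sum_def[of X W c x]) (subst suminf_ennreal_Suc, simp)

lemma path_sum_Suc: "path_sum X W c x = c x + (\<Sum>n. path_step X W ((path_step X W ^^ n) c) x)"
  unfolding path_sum_def by (subst suminf_ennreal_Suc) simp

text \<open>The partial sums of the series are the iterates, from 0, of the affine map with constant
  term \<open>c\<close>; by monotonicity they stay below every supersolution on
  \<open>X\<close>.\<close>

lemma path_sum_least:
  assumes "\<And>x. x \<in> X \<Longrightarrow> c x + path_step X W u x \<le> u x" and "x \<in> X"
  shows "path_sum X W c x \<le> u x"
proof -
  have "\<forall>x\<in>X. (\<Sum>n<N. (path_step X W ^^ n) c x) \<le> u x" for N
  proof (induction N)
    case (Suc N)
    show ?case
    proof
      fix x assume x: "x \<in> X"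
      have "(\<Sum>n<Suc N. (path_step X W ^^ n) c x)
          = c x + path_step X W (\<lambda>y. \<Sum>n<N. (path_step X W ^^ n) c y) x"
        unfolding sum.lessThan_Suc_shift path_step_sum by simp
      also have "\<dots> \<le> c x + path_step X W u x"
        using Suc by (intro add_left_mono path_step_mono) auto
      finally show "(\<Sum>n<Suc N. (path_step X W ^^ n) c x) \<le> u x"
        using assms(1)[OF x] by simp
    qed
  qed simp
  then show ?thesis
    unfolding path_sum_def using \<open>x \<in> X\<close> by (intro suminf_le_const) auto
qed

lemma path_sum_add: "path_sum X W (\<lambda>y. c y + d y) x = path_sum X W c x + path_sum X W d x"
proof -
  have "(path_step X W ^^ n) (\<lambda>y. c y + d y)
      = (\<lambda>x. (path_step X W ^^ n) c x + (path_step X W ^^ n) d x)" for n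
    by (induction n) (auto simp: path_step_add)
  then show ?thesis
    by (simp add: path_sum_def suminf_add)
qed

lemma path_sum_cmult: "path_sum X W (\<lambda>y. a * c y) x = a * path_sum X W c x"
proof -
  have "(path_step X W ^^ n) (\<lambda>y. a * c y) = (\<lambda>x. a * (path_step X W ^^ n) c x)" for n
    by (induction n) (auto simp: path_step_cmult)
  then show ?thesis
    by (simp add: path_sum_def)
qed

lemma path_sum_zero: "path_sum X W (\<lambda>y. 0) x = 0"
  using path_sum_cmult[of X W 0 "\<lambda>_. 0" x] by simp

lemma path_sum_sum: "path_sum X W (\<lambda>y. \<Sum>i\<in>I. f i y) x = (\<Sum>i\<in>I. path_sum X W (f i) x)"
  by (induction I rule: infinite_finite_induct) (auto simp: path_sum_add path_sum_zero)

lemma path_sum_linear: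
  "path_sum X W (\<lambda>y. \<Sum>i\<in>I. f i y * a i) x = (\<Sum>i\<in>I. path_sum X W (f i) x * a i)"
  using path_sum_cmult[of X W] by (simp add: path_sum_sum mult.commute[of _ "a _"])

lemma path_sum_path_step:
  "path_sum X W (path_step Z V w) x = path_step Z (\<lambda>x z. path_sum X W (\<lambda>y. V y z) x) w x"
  by (simp add: path_step_def[abs_def] path_sum_linear)

text \<open>No weight leads from the image of \<open>f\<close> to nodes outside it, so the two
  series agree term by term. The start is kept apart from \<open>X\<close> because it is typically
  an entrance; injectivity concerns intermediate nodes only.\<close>

lemma path_sum_embed:
  assumes "finite Y" "inj_on f X" "f ` X \<subseteq> Y"
    and W: "\<And>x y. x \<in> insert x\<^sub>0 X \<Longrightarrow> y \<in> X \<Longrightarrow> W' (f x) (f y) = W x y"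
    and W_out: "\<And>x z. x \<in> insert x\<^sub>0 X \<Longrightarrow> z \<in> Y - f ` X \<Longrightarrow> W' (f x) z = 0"
    and c: "\<And>x. x \<in> insert x\<^sub>0 X \<Longrightarrow> c' (f x) = c x"
  shows "path_sum Y W' c' (f x\<^sub>0) = path_sum X W c x\<^sub>0"
proof -
  have "\<forall>x\<in>insert x\<^sub>0 X. (path_step Y W' ^^ n) c' (f x) = (path_step X W ^^ n) c x" for n
  proof (induction n)
    case (Suc n)
    show ?case
    proof
      fix x assume x: "x \<in> insert x\<^sub>0 X"
      have "(path_step Y W' ^^ Suc n) c' (f x)
          = (\<Sum>z\<in>f ` X. W' (f x) z * (path_step Y W' ^^ n) c' z)"
        using assms(1,3) W_out[OF x] by (auto simp: path_step_def intro!: sum.mono_neutral_right)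
      also have "\<dots> = (\<Sum>y\<in>X. W' (f x) (f y) * (path_step Y W' ^^ n) c' (f y))"
        using assms(2) by (simp add: sum.reindex)
      also have "\<dots> = (path_step X W ^^ Suc n) c x"
        using W[OF x] Suc by (auto simp: path_step_def[of X W "(path_step X W ^^ n) c"] intro!: sum.cong)
      finally show "(path_step Y W' ^^ Suc n) c' (f x) = (path_step X W ^^ Suc n) c x" .
    qed
  qed (use c in auto)
  then show ?thesis
    by (simp add: path_sum_def)
qed

text \<open>Gaussian elimination without subtraction. A path is cut at its visits to
  \<open>Z\<close>, and between two visits it runs inside \<open>X\<close>. In terms of equations,
  those of \<open>X\<close> are solved with the values on \<open>Z\<close> as parameters, and the
  result is substituted into those of \<open>Z\<close>.\<close>

lemma path_sum_eliminate:
  assumes "finite X" "finite Z" "X \<inter> Z = {}"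
  shows "path_sum (X \<union> Z) W c x
       = path_sum Z (\<lambda>x z. path_sum X W (\<lambda>y. W y z) x) (path_sum X W c) x"
proof -
  define v where "v = path_sum (X \<union> Z) W c"
  define V where "V = (\<lambda>x z. path_sum X W (\<lambda>y. W y z) x)"
  define u where "u = path_sum Z V (path_sum X W c)"
  define b where "b w y = c y + path_step Z W w y" for w y
  have split: "path_step (X \<union> Z) W w y = path_step X W w y + path_step Z W w y" for w y
    using assms by (simp add: path_step_def sum.union_disjoint)
  have lin: "path_sum X W (b w) y = path_sum X W c y + path_step Z V w y" for w y
    unfolding b_def path_sum_add by (simp add: path_sum_path_step V_def)
  have v: "v y = b v y + path_step X W v y" for y
    unfolding v_def b_def by (subst path_sum_unfold) (simp add: split ac_simps)
  \<comment> \<open>\<open>v\<close> solves the \<open>X\<close> equations with constant term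
    \<open>b v\<close>, but it is not yet known to be the least solution, hence only an
    inequality.\<close>
  have sol_le: "path_sum X W (b v) y \<le> v y" for y
  proof -
    have "path_sum X W (b v) y = b v y + path_step X W (path_sum X W (b v)) y"
      by (rule path_sum_unfold)
    also have "\<dots> \<le> b v y + path_step X W v y"
      by (intro add_left_mono path_step_mono path_sum_least) (simp_all flip: v)
    finally show ?thesis using v[of y] by simp
  qed
  \<comment> \<open>By \<open>sol_le\<close> and \<open>lin\<close>, \<open>v\<close> is a
    supersolution of the reduced system on \<open>Z\<close>.\<close>
  have u_le: "u y \<le> v y" for y
  proof -
    have "u y = path_sum X W c y + path_step Z V u y"
      unfolding u_def by (rule path_sum_unfold)
    also have "\<dots> \<le> path_sum X W c y + path_step Z V v y"
      unfolding u_def using sol_le lin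
      by (intro add_left_mono path_step_mono path_sum_least) simp_all
    also have "\<dots> \<le> v y"
      using sol_le[of y] lin[of v y] by simp
    finally show ?thesis .
  qed
  have u_eq: "u = path_sum X W (b u)"
    unfolding lin by (rule ext) (metis path_sum_unfold u_def)
  \<comment> \<open>Conversely, unfolding the inner path sum shows that \<open>u\<close> solves the
    full system, so it lies above the least solution \<open>v\<close>.\<close>
  have u: "u y = c y + path_step (X \<union> Z) W u y" for y
  proof -
    have "u y = path_sum X W (b u) y" by (simp flip: u_eq)
    also have "\<dots> = b u y + path_step X W u y"
      by (subst path_sum_unfold) (simp flip: u_eq)
    finally show ?thesis by (simp add: b_def split ac_simps)
  qed
  have "v y \<le> u y" for y
  proof -
    have "v y = c y + path_step (X \<union> Z) W v y"
      unfolding v_def by (rule path_sum_unfold)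
    also have "\<dots> \<le> c y + path_step (X \<union> Z) W u y"
      unfolding v_def by (intro add_left_mono path_step_mono path_sum_least) (simp_all flip: u)
    finally show ?thesis using u[of y] by simp
  qed
  then show ?thesis
    using u_le by (simp add: antisym flip: v_def u_def V_def)
qed

text \<open>Values on \<open>Z\<close> that are already known enter the \<open>X\<close> equations
  as constants. In a composition, \<open>Z\<close> is the second component.\<close>

lemma path_sum_restrict:
  assumes "finite X" "finite Z" "X \<inter> Z = {}"
  shows "path_sum (X \<union> Z) W c x
       = path_sum X W (\<lambda>y. c y + path_step Z W (path_sum (X \<union> Z) W c) y) x"
    (is "_ = path_sum X W (\<lambda>y. c y + path_step Z W ?v y) x")
proof -
  have "?v x = path_sum X W c x + path_step Z (\<lambda>x z. path_sum X W (\<lambda>y. W y z) x) ?v x"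
    unfolding path_sum_eliminate[OF assms, of W c, abs_def] by (rule path_sum_unfold)
  also have "\<dots> = path_sum X W (\<lambda>y. c y + path_step Z W ?v y) x"
    by (simp add: path_sum_add path_sum_path_step)
  finally show ?thesis .
qed

section \<open>From finiteness to geometric decay\<close>

lemma ennreal_suminf_tail_le:
  fixes f :: "nat \<Rightarrow> ennreal"
  assumes "(\<Sum>n. f n) \<noteq> top_class.top" "0 < e"
  shows "\<exists>N. \<forall>k\<ge>N. (\<Sum>n. f (n + k)) \<le> e"
proof -
  have fin: "f n \<noteq> top_class.top" for n
    using assms(1) ennreal_suminf_lessD[of f top_class.top n] by (simp add: less_top)
  define g where "g n = enn2real (f n)" for n
  have f: "f n = ennreal (g n)" and g0: "g n \<ge> 0" for n
    using fin by (auto simp: g_def less_top)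
  have sm: "summable g"
    using assms(1) g0 by (intro summable_suminf_not_top) (auto simp: f)
  have "(\<lambda>k. \<Sum>n. g (n + k)) \<longlonglongrightarrow> 0"
    using tendsto_diff[OF tendsto_const summable_LIMSEQ[OF sm], of "suminf g"]
    by (simp add: suminf_minus_initial_segment[OF sm])
  then have "(\<lambda>k. ennreal (\<Sum>n. g (n + k))) \<longlonglongrightarrow> ennreal 0"
    by (rule tendsto_ennrealI)
  moreover have "ennreal (\<Sum>n. g (n + k)) = (\<Sum>n. f (n + k))" for k
    unfolding f using sm g0 by (intro suminf_ennreal2[symmetric]) (auto simp: summable_iff_shift)
  ultimately have "(\<lambda>k. \<Sum>n. f (n + k)) \<longlonglongrightarrow> 0" by simp
  then have "\<forall>\<^sub>F k in sequentially. (\<Sum>n. f (n + k)) < e"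
    using assms(2) by (rule order_tendstoD)
  then show ?thesis
    by (auto simp: eventually_sequentially intro: less_imp_le)
qed

text \<open>
  Finiteness of a path sum \<open>h\<close> already forces geometric decay of \<open>path_step ^^ n\<close> on \<open>h\<close>: some
  \<open>N\<close>-th iterate is at most \<open>h / 2\<close>, and then \<open>v = 2 (\<Sum>k<N. path_step ^^ k) h\<close> works.
\<close>

lemma path_sum_finite_imp_supersolution:
  assumes "finite X" and h: "h = path_sum X W c" and fin: "\<And>x. x \<in> X \<Longrightarrow> h x \<noteq> top_class.top"
  obtains v K where "\<And>x. x \<in> X \<Longrightarrow> h x + path_step X W v x \<le> v x"
    and "K \<noteq> top_class.top" and "\<And>x. x \<in> X \<Longrightarrow> v x \<le> K * h x"
proof -
  let ?T = "path_step X W"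
  have dec: "(?T ^^ k) h x \<le> h x" for k x
    unfolding h path_sum_funpow path_sum_def
    using suminf_offset[of "\<lambda>n. (?T ^^ n) c x" k] by simp
  have "\<exists>N. \<forall>k\<ge>N. 2 * (?T ^^ k) h x \<le> h x" if x: "x \<in> X" for x
  proof (cases "h x = 0")
    case True
    then show ?thesis using dec[of _ x] by simp
  next
    case False
    then have "0 < h x / 2" by (simp add: ennreal_zero_less_divide zero_less_iff_neq_zero)
    then obtain N where N: "\<forall>k\<ge>N. (?T ^^ k) h x \<le> h x / 2"
      using ennreal_suminf_tail_le[of "\<lambda>n. (?T ^^ n) c x" "h x / 2"] fin[OF x]
      unfolding h path_sum_funpow by (auto simp: path_sum_def)
    have "2 * (?T ^^ k) h x \<le> h x" if "k \<ge> N" for k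
    proof -
      have "2 * (?T ^^ k) h x \<le> 2 * (h x / 2)"
        using N that by (intro mult_left_mono) auto
      then show ?thesis
        by (simp add: ennreal_times_divide mult_divide_eq_ennreal mult.commute)
    qed
    then show ?thesis by blast
  qed
  then obtain N where N: "\<And>x k. x \<in> X \<Longrightarrow> k \<ge> N x \<Longrightarrow> 2 * (?T ^^ k) h x \<le> h x"
    by metis
  \<comment> \<open>One exponent for all nodes, available because \<open>X\<close> is finite;
    \<open>insert 0\<close> covers empty \<open>X\<close>.\<close>
  define M where "M = Max (insert 0 (N ` X))"
  have M: "2 * (?T ^^ M) h x \<le> h x" if "x \<in> X" for x
    using assms(1) that by (intro N) (auto simp: M_def)
  define v where "v x = 2 * (\<Sum>k<M. (?T ^^ k) h x)" for x
  have le: "h x + ?T v x \<le> v x" if x: "x \<in> X" for x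
  proof -
    have "?T v x = 2 * (\<Sum>k<M. (?T ^^ Suc k) h x)"
      unfolding v_def path_step_cmult path_step_sum by simp
    then have "?T v x + 2 * h x = 2 * (\<Sum>k<Suc M. (?T ^^ k) h x)"
      unfolding sum.lessThan_Suc_shift by (simp add: distrib_left add.commute)
    also have "\<dots> = v x + 2 * (?T ^^ M) h x"
      by (simp add: v_def distrib_left)
    also have "\<dots> \<le> v x + h x"
      using M[OF x] by (rule add_left_mono)
    \<comment> \<open>Applying the step to \<open>v\<close> shifts the summation index, and the new
      last term is at most half of \<open>h\<close>. One \<open>h x\<close> is then cancelled, which
      its finiteness permits.\<close>
    finally have "h x + (h x + ?T v x) \<le> h x + v x"
      by (metis mult_2 add.commute add.assoc)
    then show ?thesis
      using fin[OF x] by (simp only: ennreal_add_left_cancel_le) simp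
  qed
  have "v x \<le> of_nat (2 * M) * h x" for x
  proof -
    have "v x \<le> 2 * (\<Sum>k<M. h x)"
      unfolding v_def using dec by (intro mult_left_mono sum_mono) auto
    then show ?thesis by (simp add: mult.assoc)
  qed
  then show thesis
    using le that[of v "of_nat (2 * M)"] by (metis ennreal_of_nat_neq_top)
qed

section \<open>Chains as path sums\<close>

text \<open>The invariant carried through chains and operations. The bound by 1 is what finiteness
  rests on, and it survives a trace in which probability is lost in cyclic wires. What a trace takes
  from unique access is kept apart, in \<open>traceable\<close>.\<close>

definition substochastic_mdp :: "nat \<Rightarrow> nat \<Rightarrow> ('q, 'a) romdp \<Rightarrow> bool" where
  "substochastic_mdp m n A \<longleftrightarrow>
     ins A = m \<and> outs A = n \<and> finite (positions A) \<and>
     (\<forall>i<m. entry A i \<in> targets A) \<and>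
     (\<forall>s\<in>positions A. \<forall>a. \<forall>t\<in>targets A. tprob A s a t \<ge> 0) \<and>
     (\<forall>s\<in>positions A. \<forall>a. (\<Sum>t\<in>targets A. tprob A s a t) \<le> 1) \<and>
     (\<forall>s\<in>positions A. reward A s \<ge> 0)"

lemma is_romdp_imp_substochastic: "is_romdp m n A \<Longrightarrow> substochastic_mdp m n A"
proof -
  assume A: "is_romdp m n A"
  have "(\<Sum>t\<in>targets A. tprob A s a t) \<le> 1" if "s \<in> positions A" for s a
  proof -
    have "(\<Sum>t\<in>targets A. tprob A s a t) \<in> {0, 1}"
      using A that unfolding is_romdp_def by blast
    then show ?thesis by auto
  qed
  then show ?thesis
    using A unfolding is_romdp_def substochastic_mdp_def by blast
qed

lemma substochastic_mdpD:
  assumes "substochastic_mdp m n A"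
  shows "ins A = m" "outs A = n" "finite (positions A)"
    and "\<And>i. i < m \<Longrightarrow> entry A i \<in> targets A"
    and "\<And>s a t. s \<in> positions A \<Longrightarrow> t \<in> targets A \<Longrightarrow> tprob A s a t \<ge> 0"
    and "\<And>s a. s \<in> positions A \<Longrightarrow> (\<Sum>t\<in>targets A. tprob A s a t) \<le> 1"
    and "\<And>s. s \<in> positions A \<Longrightarrow> reward A s \<ge> 0"
  using assms by (auto simp: substochastic_mdp_def)

lemma Inl_in_targets [simp]: "Inl s \<in> targets A \<longleftrightarrow> s \<in> positions A"
  by (auto simp: targets_def)

lemma Inr_in_targets [simp]: "Inr j \<in> targets A \<longleftrightarrow> j < outs A"
  by (auto simp: targets_def)

lemma sum_targets:
  assumes "finite (positions A)"
  shows "(\<Sum>t\<in>targets A. f t) = (\<Sum>s\<in>positions A. f (Inl s)) + (\<Sum>j<outs A. f (Inr j))"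
  using assms by (simp add: targets_def sum.Plus)

text \<open>
  Every node is doubled into a probability level \<open>True\<close> and a reward level \<open>False\<close>, which represents
  the dual number \<open>p + r \<epsilon>\<close> by the matrix with rows \<open>(p, r)\<close> and \<open>(0, p)\<close>, the reward level
  coming first. A node \<open>Inr i\<close> stands for the entrance \<open>i\<close> when it is the source of an edge and for
  the exit \<open>i\<close> when it is the target.
\<close>

type_synonym 'q node = "('q + nat) \<times> bool"

definition dual_coeff :: "real \<Rightarrow> bool \<Rightarrow> bool \<Rightarrow> ennreal" where
  "dual_coeff \<rho> b b' = (if b = b' then 1 else if b' then ennreal \<rho> else 0)"

definition prob_weight :: "('q, unit) romdp \<Rightarrow> 'q + nat \<Rightarrow> 'q + nat \<Rightarrow> ennreal" where
  "prob_weight C t t' =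
     (case t of Inl s \<Rightarrow> ennreal (tprob C s () t') | Inr i \<Rightarrow> of_bool (entry C i = t'))"

definition node_weight :: "('q, unit) romdp \<Rightarrow> 'q node \<Rightarrow> 'q node \<Rightarrow> ennreal" where
  "node_weight C x y = prob_weight C (fst x) (fst y) *
     dual_coeff (case fst x of Inl s \<Rightarrow> reward C s | Inr i \<Rightarrow> 0) (snd x) (snd y)"

definition nodes :: "('q, 'a) romdp \<Rightarrow> 'q node set" where
  "nodes C = Inl ` positions C \<times> UNIV"

text \<open>The constant term consists of the last edges into \<open>y\<close>, so every path has at
  least one edge and its intermediate nodes are positions. Between an entrance and an exit, the
  levels \<open>True\<close> to \<open>True\<close> give the probability and \<open>False\<close> to
  \<open>True\<close> the reward entry.\<close>

definition chain_sem :: "('q, unit) romdp \<Rightarrow> 'q node \<Rightarrow> 'q node \<Rightarrow> ennreal" where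
  "chain_sem C x y = path_sum (nodes C) (node_weight C) (\<lambda>z. node_weight C z y) x"

lemma node_weight_Inl [simp]:
  "node_weight C (Inl s, b) (t, b') = ennreal (tprob C s () t) * dual_coeff (reward C s) b b'"
  by (simp add: node_weight_def prob_weight_def)

lemma node_weight_Inr [simp]:
  "node_weight C (Inr i, b) (t, b') = of_bool (entry C i = t \<and> b = b')"
  by (simp add: node_weight_def prob_weight_def dual_coeff_def)

lemma dual_coeff_simps [simp]:
  "dual_coeff \<rho> b b = 1" "dual_coeff \<rho> True False = 0" "dual_coeff \<rho> False True = ennreal \<rho>"
  by (simp_all add: dual_coeff_def)

lemma finite_nodes: "finite (positions C) \<Longrightarrow> finite (nodes C)"
  by (simp add: nodes_def)

lemma path_step_nodes:
  "path_step (nodes C) W v x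
     = (\<Sum>s\<in>positions C. W x (Inl s, True) * v (Inl s, True) + W x (Inl s, False) * v (Inl s, False))"
proof -
  have "path_step (nodes C) W v x = (\<Sum>t\<in>Inl ` positions C. \<Sum>b\<in>UNIV. W x (t, b) * v (t, b))"
    unfolding path_step_def nodes_def by (simp add: sum.cartesian_product)
  also have "\<dots> = (\<Sum>s\<in>positions C. \<Sum>b\<in>UNIV. W x (Inl s, b) * v (Inl s, b))"
    by (simp add: sum.reindex)
  finally show ?thesis
    by (simp add: UNIV_bool add.commute)
qed

lemma of_bool_mult_eq_if: "of_bool P * x = (if P then x else 0 :: 'b :: semiring_1)"
  by simp

lemma path_step_entrance:
  assumes "finite (positions C)" "entry C i \<in> targets C"
  shows "path_step (nodes C) (node_weight C) v (Inr i, b)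
       = (case entry C i of Inl s \<Rightarrow> v (Inl s, b) | Inr k \<Rightarrow> 0)"
  unfolding path_step_nodes using assms
  by (cases b; cases "entry C i") (auto simp: of_bool_mult_eq_if simp del: of_bool_eq_iff)

lemma chain_sem_unfold:
  "chain_sem C x y = node_weight C x y + path_step (nodes C) (node_weight C) (\<lambda>z. chain_sem C z y) x"
  unfolding chain_sem_def by (rule path_sum_unfold)

lemma chain_sem_entrance:
  assumes "finite (positions C)" "entry C i \<in> targets C"
  shows "chain_sem C (Inr i, b) (Inr j, b')
       = (case entry C i of Inl s \<Rightarrow> chain_sem C (Inl s, b) (Inr j, b')
          | Inr k \<Rightarrow> of_bool (k = j \<and> b = b'))"
  by (subst chain_sem_unfold, subst path_step_entrance[OF assms]) (auto split: sum.split)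

text \<open>A path can pass from level \<open>False\<close> to \<open>True\<close> but never back,
  and within a level the rewards do not enter. So path sums keep the matrix shape with rows
  \<open>(p, r)\<close> and \<open>(0, p)\<close>.\<close>

lemma chain_sem_levels:
  shows chain_sem_True_False: "chain_sem C (t, True) (t', False) = 0"
    and chain_sem_False_False: "chain_sem C (t, False) (t', False) = chain_sem C (t, True) (t', True)"
proof -
  have w [simp]: "node_weight C (t, True) (t', False) = 0"
    "node_weight C (t, False) (t', False) = node_weight C (t, True) (t', True)" for t t'
    by (simp_all add: node_weight_def)
  have "\<forall>t. (path_step (nodes C) (node_weight C) ^^ n) (\<lambda>z. node_weight C z (t', False)) (t, True) = 0
      \<and> (path_step (nodes C) (node_weight C) ^^ n) (\<lambda>z. node_weight C z (t', False)) (t, False)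
        = (path_step (nodes C) (node_weight C) ^^ n) (\<lambda>z. node_weight C z (t', True)) (t, True)" for n
    by (induction n) (simp_all add: path_step_nodes)
  then show "chain_sem C (t, True) (t', False) = 0"
    "chain_sem C (t, False) (t', False) = chain_sem C (t, True) (t', True)"
    by (simp_all add: chain_sem_def path_sum_def)
qed

section \<open>Bounds on probabilities and rewards\<close>

lemma path_sum_True_level:
  assumes "finite (positions C)"
  shows "path_sum (nodes C) (node_weight C) c (t, True)
       = path_sum (Inl ` positions C) (prob_weight C) (\<lambda>t. c (t, True)) t"
  by (rule path_sum_embed[where f = "\<lambda>t. (t, True)"])
    (use assms in \<open>auto simp: finite_nodes nodes_def inj_on_def node_weight_def dual_coeff_def\<close>)

lemma chain_sem_True_level:
  assumes "finite (positions C)"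
  shows "chain_sem C (t, True) (t', True)
       = path_sum (Inl ` positions C) (prob_weight C) (\<lambda>z. prob_weight C z t') t"
  unfolding chain_sem_def path_sum_True_level[OF assms] by (simp add: node_weight_def)

text \<open>The constant 1 is a supersolution of the system for the total exit probability: at each
  position this is the bound on the outgoing probabilities.\<close>

lemma sum_exit_prob_le_1:
  fixes C :: "('q, unit) romdp"
  assumes C: "substochastic_mdp m n C" and s: "s \<in> positions C"
  shows "(\<Sum>j<n. chain_sem C (Inl s, True) (Inr j, True)) \<le> 1"
proof -
  note D = substochastic_mdpD[OF C]
  have "(\<Sum>j<n. chain_sem C (Inl s, True) (Inr j, True))
      = path_sum (Inl ` positions C) (prob_weight C) (\<lambda>z. \<Sum>j<n. prob_weight C z (Inr j)) (Inl s)"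
    by (simp add: chain_sem_True_level D path_sum_sum)
  also have "\<dots> \<le> (\<lambda>_. 1) (Inl s)"
  proof (rule path_sum_least)
    fix x :: "'q + nat" assume "x \<in> Inl ` positions C"
    then obtain s' where x: "x = Inl s'" and s': "s' \<in> positions C" by auto
    have "(\<Sum>j<n. prob_weight C x (Inr j)) + path_step (Inl ` positions C) (prob_weight C) (\<lambda>_. 1) x
        = (\<Sum>t\<in>targets C. ennreal (tprob C s' () t))"
      by (simp add: x path_step_def prob_weight_def sum.reindex sum_targets D add.commute)
    also have "\<dots> = ennreal (\<Sum>t\<in>targets C. tprob C s' () t)"
      using D(5) s' by (intro sum_ennreal) auto
    also have "\<dots> \<le> 1"
      using D(6)[OF s'] by simp
    finally show "(\<Sum>j<n. prob_weight C x (Inr j))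
        + path_step (Inl ` positions C) (prob_weight C) (\<lambda>_. 1) x \<le> 1" .
  qed (use s in auto)
  finally show ?thesis by simp
qed

lemma sum_RPr_le_1:
  assumes C: "substochastic_mdp m n C" and i: "i < m"
  shows "(\<Sum>j<n. chain_sem C (Inr i, True) (Inr j, True)) \<le> 1"
proof (cases "entry C i")
  case (Inl s)
  then show ?thesis
    using sum_exit_prob_le_1[OF C, of s] substochastic_mdpD(4)[OF C i]
      chain_sem_entrance[OF substochastic_mdpD(3)[OF C] substochastic_mdpD(4)[OF C i]] by simp
next
  case (Inr k)
  then show ?thesis
    using chain_sem_entrance[OF substochastic_mdpD(3)[OF C] substochastic_mdpD(4)[OF C i]]
    by (simp add: of_bool_def)
qed

text \<open>A bound by a finite multiple of the probability shows both that the reward entry is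
  finite and that it vanishes where the probability does. It comes from a supersolution
  \<open>u\<close> on the doubled nodes: the exit probability \<open>h\<close> on level
  \<open>True\<close>, and on level \<open>False\<close> a multiple of the decay bound
  \<open>v\<close>.\<close>

lemma reward_level_le:
  assumes C: "substochastic_mdp m n C" and j: "j < n"
  obtains K where "K \<noteq> top_class.top"
    and "\<And>s. s \<in> positions C \<Longrightarrow>
      chain_sem C (Inl s, False) (Inr j, True) \<le> K * chain_sem C (Inl s, True) (Inr j, True)"
proof -
  note D = substochastic_mdpD[OF C]
  let ?X = "Inl ` positions C" and ?c = "\<lambda>z. node_weight C z (Inr j, True)"
  define h where "h = path_sum ?X (prob_weight C) (\<lambda>z. prob_weight C z (Inr j))"
  have h: "h (Inl s) = chain_sem C (Inl s, True) (Inr j, True)" for s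
    by (simp add: h_def chain_sem_True_level D)
  have "h (Inl s) \<noteq> top_class.top" if "s \<in> positions C" for s
  proof -
    have "h (Inl s) \<le> (\<Sum>j<n. chain_sem C (Inl s, True) (Inr j, True))"
      unfolding h using j by (intro member_le_sum) auto
    also have "\<dots> \<le> 1" using sum_exit_prob_le_1[OF C that] .
    finally show ?thesis by (auto simp: top_unique)
  qed
  then obtain v K where v: "\<And>x. x \<in> ?X \<Longrightarrow> h x + path_step ?X (prob_weight C) v x \<le> v x"
    and K: "K \<noteq> top_class.top" "\<And>x. x \<in> ?X \<Longrightarrow> v x \<le> K * h x"
    using path_sum_finite_imp_supersolution[of ?X h "prob_weight C"] D(3) h_def by blast
  \<comment> \<open>Any common bound on the rewards would do; the sum also makes sense when there
    are no positions.\<close>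
  define \<rho> where "\<rho> = ennreal (\<Sum>s\<in>positions C. reward C s)"
  have \<rho>: "ennreal (reward C s) \<le> \<rho>" if "s \<in> positions C" for s
    unfolding \<rho>_def using that D by (intro ennreal_leI member_le_sum) auto
  define u where "u x = (if snd x then h (fst x) else \<rho> * v (fst x))" for x
  have pre: "?c x + path_step (nodes C) (node_weight C) u x \<le> u x" if "x \<in> nodes C" for x
  proof -
    obtain s b where x: "x = (Inl s, b)" and s: "s \<in> positions C"
      using \<open>x \<in> nodes C\<close> by (auto simp: nodes_def)
    have h_eq: "h (Inl s) = ennreal (tprob C s () (Inr j))
        + (\<Sum>s'\<in>positions C. ennreal (tprob C s () (Inl s')) * h (Inl s'))"
      unfolding h_def
      by (subst path_sum_unfold) (simp add: path_step_def sum.reindex prob_weight_def)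
    show ?thesis
    proof (cases b)
      case True
      then show ?thesis
        by (simp add: x u_def path_step_nodes flip: h_eq)
    next
      case False
      have step: "path_step ?X (prob_weight C) v (Inl s)
          = (\<Sum>s'\<in>positions C. ennreal (tprob C s () (Inl s')) * v (Inl s'))"
        by (simp add: path_step_def sum.reindex prob_weight_def)
      \<comment> \<open>By the equation for \<open>h\<close>, the edges that switch level contribute
        the reward of \<open>s\<close> times \<open>h (Inl s)\<close>; all other edges stay on the
        reward level.\<close>
      have "?c x + path_step (nodes C) (node_weight C) u x
          = ennreal (reward C s) * h (Inl s) + \<rho> * path_step ?X (prob_weight C) v (Inl s)"
        unfolding h_eq step using False
        by (simp add: x u_def path_step_nodes sum_distrib_left sum.distrib algebra_simps)
      also have "\<dots> \<le> \<rho> * (h (Inl s) + path_step ?X (prob_weight C) v (Inl s))"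
        unfolding distrib_left using \<rho>[OF s] by (intro add_right_mono mult_right_mono) auto
      also have "\<dots> \<le> u x"
        using v[of "Inl s"] s False by (auto simp: x u_def intro!: mult_left_mono)
      finally show ?thesis .
    qed
  qed
  have "chain_sem C (Inl s, False) (Inr j, True) \<le> (\<rho> * K) * chain_sem C (Inl s, True) (Inr j, True)"
    if s: "s \<in> positions C" for s
  proof -
    have "chain_sem C (Inl s, False) (Inr j, True) \<le> u (Inl s, False)"
      unfolding chain_sem_def using pre s by (intro path_sum_least) (auto simp: nodes_def)
    also have "\<dots> \<le> \<rho> * (K * h (Inl s))"
      unfolding u_def using K(2)[of "Inl s"] s by (auto intro!: mult_left_mono)
    finally show ?thesis by (simp add: h mult.assoc)
  qed
  moreover have "\<rho> * K \<noteq> top_class.top"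
    using K(1) by (auto simp: \<rho>_def ennreal_mult_eq_top_iff)
  ultimately show thesis using that by blast
qed

lemma chain_sem_finite_and_support:
  assumes C: "substochastic_mdp m n C" and "i < m" "j < n"
  shows chain_sem_finite: "chain_sem C (Inr i, b) (Inr j, True) \<noteq> top_class.top"
    and chain_sem_support: "chain_sem C (Inr i, True) (Inr j, True) = 0 \<Longrightarrow>
      chain_sem C (Inr i, False) (Inr j, True) = 0"
proof -
  note D = substochastic_mdpD[OF C]
  note entrance = chain_sem_entrance[OF D(3) D(4)[OF \<open>i < m\<close>]]
  obtain K where K: "K \<noteq> top_class.top" "\<And>s. s \<in> positions C \<Longrightarrow>
      chain_sem C (Inl s, False) (Inr j, True) \<le> K * chain_sem C (Inl s, True) (Inr j, True)"
    using reward_level_le[OF C \<open>j < n\<close>] by blast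
  have le: "chain_sem C (Inr i, False) (Inr j, True) \<le> K * chain_sem C (Inr i, True) (Inr j, True)"
    using K(2) D(4)[OF \<open>i < m\<close>] by (auto simp: entrance split: sum.split)
  have "chain_sem C (Inr i, True) (Inr j, True)
      \<le> (\<Sum>j<n. chain_sem C (Inr i, True) (Inr j, True))"
    using \<open>j < n\<close> by (intro member_le_sum) auto
  also note sum_RPr_le_1[OF C \<open>i < m\<close>]
  finally have T: "chain_sem C (Inr i, True) (Inr j, True) \<noteq> top_class.top"
    by (auto simp: top_unique)
  then have "K * chain_sem C (Inr i, True) (Inr j, True) \<noteq> top_class.top"
    using K(1) by (auto simp: ennreal_mult_eq_top_iff)
  with le have "chain_sem C (Inr i, False) (Inr j, True) \<noteq> top_class.top"
    by (auto simp: top_unique)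
  with T show "chain_sem C (Inr i, b) (Inr j, True) \<noteq> top_class.top" by (cases b) auto
  show "chain_sem C (Inr i, True) (Inr j, True) = 0 \<Longrightarrow> chain_sem C (Inr i, False) (Inr j, True) = 0"
    using le by simp
qed

text \<open>A nonnegative unconditional sum may be taken level by level. It is applied to paths
  graded by length, whose levels are finite because there are finitely many positions.\<close>

lemma infsum_graded:
  fixes f :: "'x \<Rightarrow> real" and g :: "'x \<Rightarrow> nat"
  assumes nonneg: "\<And>x. x \<in> A \<Longrightarrow> f x \<ge> 0"
    and fin: "\<And>n. finite {x \<in> A. g x = n}"
    and bound: "(\<Sum>n. \<Sum>x | x \<in> A \<and> g x = n. ennreal (f x)) \<noteq> top_class.top"
  shows "infsum f A = enn2real (\<Sum>n. \<Sum>x | x \<in> A \<and> g x = n. ennreal (f x))"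
proof -
  define a where "a n = (\<Sum>x | x \<in> A \<and> g x = n. f x)" for n
  have a0: "a n \<ge> 0" for n
    unfolding a_def using nonneg by (intro sum_nonneg) auto
  have ea: "(\<Sum>x | x \<in> A \<and> g x = n. ennreal (f x)) = ennreal (a n)" for n
    unfolding a_def using nonneg by (intro sum_ennreal) auto
  have sm: "summable a"
    using bound a0 unfolding ea by (intro summable_suminf_not_top)
  have part: "(\<Sum>n<N. a n) = sum f {x \<in> A. g x < N}" for N
  proof -
    have "sum f (\<Union>n\<in>{..<N}. {x \<in> A. g x = n}) = (\<Sum>n<N. a n)"
      unfolding a_def using fin by (intro sum.UNION_disjoint) auto
    moreover have "(\<Union>n\<in>{..<N}. {x \<in> A. g x = n}) = {x \<in> A. g x < N}" by auto
    ultimately show ?thesis by simp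
  qed
  have fin_less: "finite {x \<in> A. g x < N}" for N
  proof -
    have "{x \<in> A. g x < N} = (\<Union>n\<in>{..<N}. {x \<in> A. g x = n})" by auto
    then show ?thesis using fin by simp
  qed
  have le: "sum f F \<le> suminf a" if F: "F \<subseteq> A" "finite F" for F
  proof -
    define N where "N = Suc (Max (insert 0 (g ` F)))"
    have "F \<subseteq> {x \<in> A. g x < N}"
      using F by (auto simp: N_def less_Suc_eq_le)
    then have "sum f F \<le> (\<Sum>n<N. a n)"
      unfolding part using nonneg fin_less by (intro sum_mono2) auto
    also have "\<dots> \<le> suminf a"
      using sm a0 by (intro sum_le_suminf) auto
    finally show ?thesis .
  qed
  have summ: "f summable_on A"
    using nonneg le by (intro nonneg_bdd_above_summable_on) (auto simp: bdd_above_def)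
  have "infsum f A \<le> suminf a"
    using le by (intro infsum_le_finite_sums[OF summ]) auto
  moreover have "suminf a \<le> infsum f A"
  proof (rule suminf_le_const[OF sm])
    fix N
    show "sum a {..<N} \<le> infsum f A"
      unfolding part using fin_less nonneg by (intro finite_sum_le_infsum[OF summ]) auto
  qed
  moreover have "enn2real (\<Sum>n. ennreal (a n)) = suminf a"
    using suminf_ennreal2[OF a0 sm] suminf_nonneg[OF sm a0] by simp
  ultimately show ?thesis
    unfolding ea by linarith
qed

section \<open>Path lists as terms of the path sum\<close>

lemma path_prob_Nil [simp]: "path_prob C [] j = 1"
  by (simp add: path_prob_def)

lemma path_prob_Cons:
  "path_prob C (s # ss) j = tprob C s () (hd (path_tail ss j)) * path_prob C ss j"
  unfolding path_prob_def length_Cons prod.lessThan_Suc_shift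
  by (simp add: path_tail_def hd_conv_nth)

lemma path_reward_simps [simp]:
  "path_reward C [] = 0" "path_reward C (s # ss) = reward C s + path_reward C ss"
  by (simp_all add: path_reward_def)

lemma hd_path_tail [simp]: "hd (path_tail [] j) = Inr j" "hd (path_tail (s # ss) j) = Inl s"
  by (simp_all add: path_tail_def)

lemma hd_path_tail_in_targets:
  "set ss \<subseteq> positions C \<Longrightarrow> j < outs C \<Longrightarrow> hd (path_tail ss j) \<in> targets C"
  by (cases ss) auto

lemma path_prob_nonneg:
  assumes "substochastic_mdp m n C" "set ss \<subseteq> positions C" "j < n"
  shows "path_prob C ss j \<ge> 0"
  using assms(2)
proof (induction ss)
  case (Cons s ss)
  then show ?case
    using substochastic_mdpD[OF assms(1)] assms(3)
    by (auto simp: path_prob_Cons intro!: mult_nonneg_nonneg hd_path_tail_in_targets)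
qed simp

lemma path_reward_nonneg:
  assumes "substochastic_mdp m n C" "set ss \<subseteq> positions C"
  shows "path_reward C ss \<ge> 0"
  using assms(2) substochastic_mdpD(7)[OF assms(1)] by (induction ss) auto

text \<open>The weight of a path in the doubled graph from level \<open>b\<close> to level
  \<open>True\<close>: its probability, or its probability times its reward.\<close>

definition path_value :: "('q, unit) romdp \<Rightarrow> bool \<Rightarrow> 'q list \<Rightarrow> nat \<Rightarrow> real" where
  "path_value C b ss j = path_prob C ss j * (if b then 1 else path_reward C ss)"

lemma path_value_nonneg:
  assumes "substochastic_mdp m n C" "set ss \<subseteq> positions C" "j < n"
  shows "path_value C b ss j \<ge> 0"
  using path_prob_nonneg[OF assms] path_reward_nonneg[OF assms(1,2)] by (simp add: path_value_def)

text \<open>Multiplication of dual numbers: rewards add along a path, so on level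
  \<open>False\<close> either \<open>s\<close> pays its reward and the rest counts as probability,
  or the rest pays.\<close>

lemma path_value_Cons:
  assumes C: "substochastic_mdp m n C" and "s \<in> positions C" "set ss \<subseteq> positions C" "j < n"
  shows "ennreal (path_value C b (s # ss) j)
       = ennreal (tprob C s () (hd (path_tail ss j))) *
         (dual_coeff (reward C s) b True * ennreal (path_value C True ss j) +
          dual_coeff (reward C s) b False * ennreal (path_value C False ss j))"
proof -
  note D = substochastic_mdpD[OF C]
  have "tprob C s () (hd (path_tail ss j)) \<ge> 0" "reward C s \<ge> 0"
    using assms D(2) by (auto intro!: D(5,7) hd_path_tail_in_targets)
  then show ?thesis
    using path_prob_nonneg[OF C assms(3,4)] path_reward_nonneg[OF C assms(3)]
    by (cases b) (simp_all add: path_value_def path_prob_Cons algebra_simps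
        flip: ennreal_mult ennreal_plus)
qed

text \<open>The exponent counts the positions after the start \<open>s\<close>; the final edge to
  the exit is in the constant term.\<close>

lemma funpow_path_step_position:
  assumes C: "substochastic_mdp m n C" and j: "j < n" and "s \<in> positions C"
  shows "(path_step (nodes C) (node_weight C) ^^ k) (\<lambda>z. node_weight C z (Inr j, True)) (Inl s, b)
       = (\<Sum>ss | set ss \<subseteq> positions C \<and> length ss = k. ennreal (path_value C b (s # ss) j))"
  using \<open>s \<in> positions C\<close>
proof (induction k arbitrary: s b)
  case 0
  have "{ss. set ss \<subseteq> positions C \<and> length ss = 0} = {[]}" by auto
  then show ?case
    using path_value_Cons[OF C 0 _ j, of "[]" b] by (simp add: path_value_def)
next
  case (Suc k)
  let ?L = "{ss. set ss \<subseteq> positions C \<and> length ss = k}"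
  let ?d = "dual_coeff (reward C s) b"
  have inj: "inj_on (\<lambda>(xs, n). n # xs) (?L \<times> positions C)"
    by (auto simp: inj_on_def)
  have "(\<Sum>ss | set ss \<subseteq> positions C \<and> length ss = Suc k. ennreal (path_value C b (s # ss) j))
      = (\<Sum>(ss, s')\<in>?L \<times> positions C. ennreal (path_value C b (s # s' # ss) j))"
    unfolding lists_length_Suc_eq by (subst sum.reindex[OF inj]) (simp add: case_prod_unfold)
  also have "\<dots> = (\<Sum>s'\<in>positions C. \<Sum>ss\<in>?L. ennreal (path_value C b (s # s' # ss) j))"
    unfolding sum.cartesian_product[symmetric] by (rule sum.swap)
  also have "\<dots> = (\<Sum>s'\<in>positions C. \<Sum>ss\<in>?L. ennreal (tprob C s () (Inl s')) *
      (?d True * ennreal (path_value C True (s' # ss) j) +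
       ?d False * ennreal (path_value C False (s' # ss) j)))"
    using path_value_Cons[OF C Suc.prems _ j] by (intro sum.cong) auto
  also have "\<dots> = (\<Sum>s'\<in>positions C. ennreal (tprob C s () (Inl s')) *
      (?d True * (\<Sum>ss\<in>?L. ennreal (path_value C True (s' # ss) j)) +
       ?d False * (\<Sum>ss\<in>?L. ennreal (path_value C False (s' # ss) j))))"
    by (simp add: sum_distrib_left sum.distrib algebra_simps)
  finally show ?case
    using Suc.IH by (simp add: path_step_nodes algebra_simps)
qed

text \<open>From an entrance the first edge has weight 1 and keeps the level, so here the exponent
  is the number of all positions on the path. Exponent 0 is an entrance wired directly to the
  exit.\<close>

lemma funpow_path_step_entrance:
  assumes C: "substochastic_mdp m n C" and i: "i < m" and j: "j < n"
  shows "(path_step (nodes C) (node_weight C) ^^ k) (\<lambda>z. node_weight C z (Inr j, True)) (Inr i, b)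
       = (\<Sum>ss | ss \<in> paths C i j \<and> length ss = k. ennreal (path_value C b ss j))"
proof (cases k)
  case 0
  have "{ss. ss \<in> paths C i j \<and> length ss = k} = (if entry C i = Inr j then {[]} else {})"
    using 0 by (auto simp: paths_def)
  then show ?thesis
    using 0 by (cases b) (simp_all add: path_value_def)
next
  case (Suc k')
  note D = substochastic_mdpD[OF C]
  show ?thesis
  proof (cases "entry C i")
    case (Inl s)
    then have s: "s \<in> positions C" using D(4)[OF i] by simp
    let ?L = "{ss. set ss \<subseteq> positions C \<and> length ss = k'}"
    have "{ss. ss \<in> paths C i j \<and> length ss = k} = (#) s ` ?L"
      using Suc Inl s by (auto simp: paths_def length_Suc_conv image_iff)
    then show ?thesis
      using Inl Suc D(3) D(4)[OF i]
      by (simp add: path_step_entrance funpow_path_step_position[OF C j s] sum.reindex)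
  next
    case (Inr k'')
    then have *: "{ss. ss \<in> paths C i j \<and> length ss = k} = {}"
      using Suc by (auto simp: paths_def length_Suc_conv)
    show ?thesis
      unfolding * using Inr Suc D(3) D(4)[OF i] by (simp add: path_step_entrance)
  qed
qed

lemma infsum_paths:
  assumes C: "substochastic_mdp m n C" and i: "i < m" and j: "j < n"
  shows "(\<Sum>\<^sub>\<infinity>ss\<in>paths C i j. path_value C b ss j) = enn2real (chain_sem C (Inr i, b) (Inr j, True))"
proof -
  have eq: "chain_sem C (Inr i, b) (Inr j, True)
      = (\<Sum>k. \<Sum>ss | ss \<in> paths C i j \<and> length ss = k. ennreal (path_value C b ss j))"
    by (simp add: chain_sem_def path_sum_def funpow_path_step_entrance[OF assms])
  have "finite {ss \<in> paths C i j. length ss = k}" for k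
    by (rule finite_subset[OF _ finite_lists_length_eq[OF substochastic_mdpD(3)[OF C], of k]])
      (auto simp: paths_def)
  then show ?thesis
    unfolding eq using chain_sem_finite[OF assms, of b] path_value_nonneg[OF C _ j]
    by (intro infsum_graded) (auto simp: eq paths_def)
qed

text \<open>The interface to path lists: composition, sum and trace are treated through this
  formula, in terms of \<open>chain_sem\<close> alone.\<close>

lemma mc_sem_eq:
  assumes C: "substochastic_mdp m n C"
  shows "mc_sem C =
     (mat m n (\<lambda>(i, j). enn2real (chain_sem C (Inr i, True) (Inr j, True))),
      mat m n (\<lambda>(i, j). enn2real (chain_sem C (Inr i, False) (Inr j, True))))"
proof -
  have "RPr C i j = enn2real (chain_sem C (Inr i, True) (Inr j, True))"
    "ERw C i j = enn2real (chain_sem C (Inr i, False) (Inr j, True))" if "i < m" "j < n" for i j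
    using infsum_paths[OF C that, of True] infsum_paths[OF C that, of False]
    by (simp_all add: RPr_def ERw_def path_value_def)
  then show ?thesis
    using substochastic_mdpD(1,2)[OF C] by (auto simp: mc_sem_def intro!: eq_matI)
qed

lemma mc_sem_in_mc_arrows:
  assumes C: "substochastic_mdp m n C"
  shows "mc_sem C \<in> mc_arrows m n"
proof -
  have "(\<Sum>j<n. enn2real (chain_sem C (Inr i, True) (Inr j, True))) \<le> 1" if "i < m" for i
  proof -
    have "ennreal (\<Sum>j<n. enn2real (chain_sem C (Inr i, True) (Inr j, True)))
        = (\<Sum>j<n. chain_sem C (Inr i, True) (Inr j, True))"
      using chain_sem_finite[OF C that]
      by (subst sum_ennreal[symmetric]) (auto simp: less_top intro!: sum.cong)
    also note sum_RPr_le_1[OF C that]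
    finally show ?thesis by simp
  qed
  moreover have "chain_sem C (Inr i, False) (Inr j, True) = 0"
    if "i < m" "j < n" "enn2real (chain_sem C (Inr i, True) (Inr j, True)) = 0" for i j
    using that chain_sem_support[OF C that(1,2)] chain_sem_finite[OF C that(1,2), of True]
    by (auto simp: enn2real_eq_0_iff)
  ultimately show ?thesis
    unfolding mc_sem_eq[OF C] mc_arrows_def by auto
qed

section \<open>Invariance under isomorphism\<close>

lemma bij_betw_targets:
  assumes "bij_betw f (positions A) (positions B)" "outs A = outs B"
  shows "bij_betw (map_sum f id) (targets A) (targets B)"
proof -
  have inj: "inj_on f (positions A)" and im: "f ` positions A = positions B"
    using assms(1) by (auto simp: bij_betw_def)
  have "inj_on (map_sum f id) (targets A)"
  proof (rule inj_onI)
    fix t u assume "t \<in> targets A" "u \<in> targets A" "map_sum f id t = map_sum f id u"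
    then show "t = u" using inj_onD[OF inj] by (cases t; cases u) auto
  qed
  moreover have "map_sum f id ` targets A = targets B"
    using assms(2) unfolding targets_def im[symmetric] by (simp add: Plus_def image_Un image_image)
  ultimately show ?thesis by (simp add: bij_betw_def)
qed

text \<open>The operations of \<open>roMDP\<close> range over all representatives of a class, so
  each of these has to be known to be an roMDP.\<close>

lemma is_romdp_iso:
  assumes A: "is_romdp m n A" and iso: "romdp_iso A B"
  shows "is_romdp m n B"
proof -
  obtain f where bij: "bij_betw f (positions A) (positions B)"
    and io: "ins A = ins B" "outs A = outs B"
    and e: "\<And>i. i < ins A \<Longrightarrow> entry B i = map_sum f id (entry A i)"
    and p: "\<And>s a t. s \<in> positions A \<Longrightarrow> t \<in> targets A \<Longrightarrow>
      tprob B (f s) a (map_sum f id t) = tprob A s a t"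
    and r: "\<And>s. s \<in> positions A \<Longrightarrow> reward B (f s) = reward A s"
    using iso unfolding romdp_iso_def by blast
  note bijt = bij_betw_targets[OF bij io(2)]
  have posB: "positions B = f ` positions A" and tB: "targets B = map_sum f id ` targets A"
    using bij bijt by (auto simp: bij_betw_def)
  have AD: "ins A = m" "outs A = n" "finite (positions A)" "\<And>i. i < m \<Longrightarrow> entry A i \<in> targets A"
    "\<And>s a t. s \<in> positions A \<Longrightarrow> t \<in> targets A \<Longrightarrow> tprob A s a t \<ge> 0"
    "\<And>s a. s \<in> positions A \<Longrightarrow> (\<Sum>t\<in>targets A. tprob A s a t) \<in> {0, 1}"
    "\<And>s. s \<in> positions A \<Longrightarrow> reward A s \<ge> 0" "unique_access A"
    using A by (auto simp: is_romdp_def)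
  have sums: "(\<Sum>t\<in>targets B. tprob B (f s) a t) = (\<Sum>t\<in>targets A. tprob A s a t)"
    if "s \<in> positions A" for s a
    using p[OF that] by (simp add: sum.reindex_bij_betw[OF bijt, symmetric])
  have pr: "tprob B (f s) a (Inr j) = tprob A s a (Inr j)"
    if "s \<in> positions A" "j < outs A" for s a j
    using p[OF that(1), of "Inr j" a] that(2) by simp
  have re: "reached_exits B (map_sum id f x) = reached_exits A x"
    if "x \<in> {..<ins A} <+> positions A" for x
    using that
  proof (elim PlusE)
    fix i assume i: "i \<in> {..<ins A}" "x = Inl i"
    have "map_sum f id t = Inr j \<longleftrightarrow> t = Inr j" for t and j :: nat by (cases t) auto
    then show ?thesis using i e io by simp
  next
    fix s assume s: "s \<in> positions A" "x = Inr s"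
    then show ?thesis using pr io by auto
  qed
  have UA: "\<And>x y. x \<in> {..<ins A} <+> positions A \<Longrightarrow> y \<in> {..<ins A} <+> positions A \<Longrightarrow>
      x \<noteq> y \<Longrightarrow> reached_exits A x \<inter> reached_exits A y = {}"
    and UA': "\<And>s a b j. s \<in> positions A \<Longrightarrow> j < outs A \<Longrightarrow>
      tprob A s a (Inr j) > 0 \<Longrightarrow> tprob A s b (Inr j) > 0 \<Longrightarrow> a = b"
    using AD(8) unfolding unique_access_def by blast+
  have src: "\<exists>x'\<in>{..<ins A} <+> positions A. x = map_sum id f x'" if "x \<in> {..<ins B} <+> positions B" for x
    using that io unfolding posB by (auto simp: Plus_def image_iff) force+
  have "unique_access B"
    unfolding unique_access_def
  proof (intro conjI ballI allI impI)
    fix x y assume "x \<in> {..<ins B} <+> positions B" "y \<in> {..<ins B} <+> positions B" "x \<noteq> y"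
    then obtain x' y' where xy: "x' \<in> {..<ins A} <+> positions A" "y' \<in> {..<ins A} <+> positions A"
      "x = map_sum id f x'" "y = map_sum id f y'" "x' \<noteq> y'"
      using src by metis
    then show "reached_exits B x \<inter> reached_exits B y = {}"
      using UA[of x' y'] re by simp
  next
    fix s a b j assume "s \<in> positions B" "j < outs B"
      "tprob B s a (Inr j) > 0 \<and> tprob B s b (Inr j) > 0"
    then show "a = b" using UA' pr io unfolding posB by auto
  qed
  moreover have "entry B i \<in> targets B" if "i < m" for i
    using AD(4)[OF that] e that AD(1) unfolding tB by simp
  moreover have "tprob B s a t \<ge> 0" if "s \<in> positions B" "t \<in> targets B" for s a t
    using that AD(5) p unfolding posB tB by auto
  moreover have "(\<Sum>t\<in>targets B. tprob B s a t) \<in> {0, 1}" if "s \<in> positions B" for s a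
    using that sums AD(6) unfolding posB by (metis imageE)
  ultimately show ?thesis
    using AD(1,2,3,7) io r unfolding is_romdp_def by (auto simp: posB)
qed

text \<open>Paths correspond under \<open>map f\<close>. The assumption on the entries ensures that
  their first elements can be compared, since \<open>map_sum f id\<close> is injective on
  \<open>targets C\<close>.\<close>

lemma mc_sem_iso:
  assumes iso: "romdp_iso C D" and ent: "\<And>i. i < ins C \<Longrightarrow> entry C i \<in> targets C"
  shows "mc_sem D = mc_sem C"
proof -
  obtain f where bij: "bij_betw f (positions C) (positions D)"
    and io: "ins C = ins D" "outs C = outs D"
    and e: "\<And>i. i < ins C \<Longrightarrow> entry D i = map_sum f id (entry C i)"
    and p: "\<And>s a t. s \<in> positions C \<Longrightarrow> t \<in> targets C \<Longrightarrow>
      tprob D (f s) a (map_sum f id t) = tprob C s a t"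
    and r: "\<And>s. s \<in> positions C \<Longrightarrow> reward D (f s) = reward C s"
    using iso unfolding romdp_iso_def by blast
  have inj: "inj_on f (positions C)" and posD: "positions D = f ` positions C"
    using bij by (auto simp: bij_betw_def)
  have injt: "inj_on (map_sum f id) (targets C)"
    using bij_betw_targets[OF bij io(2)] by (simp add: bij_betw_def)
  have hd_map: "hd (path_tail (map f ss) j) = map_sum f id (hd (path_tail ss j))" for ss j
    by (cases ss) auto
  have prob: "path_prob D (map f ss) j = path_prob C ss j" if "set ss \<subseteq> positions C" "j < outs C" for ss j
    using that by (induction ss) (auto simp: path_prob_Cons hd_map p hd_path_tail_in_targets)
  have rew: "path_reward D (map f ss) = path_reward C ss" if "set ss \<subseteq> positions C" for ss
    using that by (induction ss) (auto simp: r)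
  have paths: "paths D i j = map f ` paths C i j" if "i < ins C" "j < outs C" for i j
  proof -
    have eq: "hd (path_tail (map f ss) j) = entry D i \<longleftrightarrow> hd (path_tail ss j) = entry C i"
      if "set ss \<subseteq> positions C" for ss
      using inj_on_eq_iff[OF injt hd_path_tail_in_targets[OF that] ent] \<open>i < ins C\<close> \<open>j < outs C\<close> e
      by (simp add: hd_map)
    have "paths D i j = {ss \<in> lists (positions D). hd (path_tail ss j) = entry D i}"
      by (auto simp: paths_def)
    also have "\<dots> = map f ` {ss \<in> lists (positions C). hd (path_tail (map f ss) j) = entry D i}"
      unfolding posD lists_image by blast
    also have "{ss \<in> lists (positions C). hd (path_tail (map f ss) j) = entry D i} = paths C i j"
      unfolding paths_def in_lists_conv_set subset_iff[symmetric] using eq by blast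
    finally show ?thesis .
  qed
  have inj_map: "inj_on (map f) (paths C i j)" for i j
  proof (rule inj_onI)
    fix xs ys assume "xs \<in> paths C i j" "ys \<in> paths C i j" "map f xs = map f ys"
    then show "xs = ys"
      using map_inj_on[of f xs ys] inj_on_subset[OF inj, of "set xs \<union> set ys"]
      by (simp add: paths_def)
  qed
  have "RPr D i j = RPr C i j" "ERw D i j = ERw C i j" if "i < ins C" "j < outs C" for i j
    unfolding RPr_def ERw_def paths[OF that] infsum_reindex[OF inj_map]
    using that(2) prob rew by (auto simp: paths_def o_def intro!: infsum_cong)
  then show ?thesis
    using io by (auto simp: mc_sem_def intro!: eq_matI)
qed

section \<open>Schedulers and representatives\<close>

lemma induced_chain_simps [simp]:
  "ins (induced_chain A \<tau>) = ins A" "outs (induced_chain A \<tau>) = outs A"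
  "positions (induced_chain A \<tau>) = positions A" "entry (induced_chain A \<tau>) = entry A"
  "tprob (induced_chain A \<tau>) = (\<lambda>s _. tprob A s (\<tau> s))" "reward (induced_chain A \<tau>) = reward A"
  "targets (induced_chain A \<tau>) = targets A"
  by (auto simp: induced_chain_def targets_def)

lemma substochastic_induced_chain:
  "substochastic_mdp m n A \<Longrightarrow> substochastic_mdp m n (induced_chain A \<tau>)"
  by (simp add: substochastic_mdp_def)

text \<open>Schedulers are transported along \<open>f\<close> in one direction and along an inverse
  \<open>g\<close> in the other. They are total functions, but agreement on positions is enough for
  equal semantics.\<close>

lemma romdp_sem_iso:
  assumes iso: "romdp_iso A B" and ent: "\<And>i. i < ins A \<Longrightarrow> entry A i \<in> targets A"
  shows "romdp_sem B = romdp_sem A"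
proof -
  obtain f where bij: "bij_betw f (positions A) (positions B)"
    and io: "ins A = ins B" "outs A = outs B"
    and e: "\<And>i. i < ins A \<Longrightarrow> entry B i = map_sum f id (entry A i)"
    and p: "\<And>s a t. s \<in> positions A \<Longrightarrow> t \<in> targets A \<Longrightarrow>
      tprob B (f s) a (map_sum f id t) = tprob A s a t"
    and r: "\<And>s. s \<in> positions A \<Longrightarrow> reward B (f s) = reward A s"
    using iso unfolding romdp_iso_def by blast
  have sem: "mc_sem (induced_chain B \<tau>') = mc_sem (induced_chain A \<tau>)"
    if "\<And>s. s \<in> positions A \<Longrightarrow> \<tau>' (f s) = \<tau> s" for \<tau> \<tau>'
  proof (rule mc_sem_iso)
    show "romdp_iso (induced_chain A \<tau>) (induced_chain B \<tau>')"
      unfolding romdp_iso_def using that bij io e p r by (auto intro!: exI[of _ f])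
  qed (use ent in auto)
  define g where "g = inv_into (positions A) f"
  have g: "g (f s) = s" if "s \<in> positions A" for s
    using bij that by (auto simp: g_def bij_betw_def)
  have "mc_sem (induced_chain B \<tau>) = mc_sem (induced_chain A (\<tau> \<circ> f))" for \<tau>
    by (rule sem) simp
  moreover have "mc_sem (induced_chain A \<tau>) = mc_sem (induced_chain B (\<tau> \<circ> g))" for \<tau>
    by (rule sem[symmetric]) (simp add: g)
  ultimately show ?thesis
    unfolding romdp_sem_def by blast
qed

text \<open>\<open>sem_functor\<close> is a union over the class, so an empty class would lose the
  semantics. Operations produce positions of another type than \<open>nat\<close>; an injection into
  \<open>nat\<close> yields a representative.\<close>

lemma iso_class_nonempty:
  fixes A :: "('q, 'a) romdp"
  assumes "finite (positions A)"
  shows "iso_class A \<noteq> {}"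
proof -
  obtain f :: "'q \<Rightarrow> nat" where inj: "inj_on f (positions A)"
    using finite_imp_inj_to_nat_seg[OF assms] by blast
  define g where "g = inv_into (positions A) f"
  have g: "g (f s) = s" if "s \<in> positions A" for s
    using inj that by (simp add: g_def)
  define B where "B = \<lparr>ins = ins A, outs = outs A, positions = f ` positions A,
    entry = (\<lambda>i. map_sum f id (entry A i)),
    tprob = (\<lambda>s a t. tprob A (g s) a (map_sum g id t)), reward = (\<lambda>s. reward A (g s))\<rparr>"
  have "map_sum g id (map_sum f id t) = t" if "t \<in> targets A" for t
    using that g by (cases t) auto
  then have "romdp_iso A B"
    unfolding romdp_iso_def B_def using inj g
    by (auto intro!: exI[of _ f] inj_on_imp_bij_betw)
  then show ?thesis
    by (auto simp: iso_class_def)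
qed

section \<open>Wirings\<close>

lemma mc_sem_no_positions:
  assumes C: "substochastic_mdp m n C" and "positions C = {}"
  shows "mc_sem C = (mat m n (\<lambda>(i, j). of_bool (entry C i = Inr j)), 0\<^sub>m m n)"
proof -
  have "nodes C = {}" using assms(2) by (simp add: nodes_def)
  then have "chain_sem C (Inr i, b) (Inr j, True) = of_bool (entry C i = Inr j \<and> b)" for i j b
    by (simp add: chain_sem_def)
  then show ?thesis
    unfolding mc_sem_eq[OF C] by (auto intro!: eq_matI)
qed

lemma romdp_sem_no_positions:
  assumes "substochastic_mdp m n A" "positions A = {}"
  shows "romdp_sem A = {(mat m n (\<lambda>(i, j). of_bool (entry A i = Inr j)), 0\<^sub>m m n)}"
proof -
  have "mc_sem (induced_chain A \<tau>) = (mat m n (\<lambda>(i, j). of_bool (entry A i = Inr j)), 0\<^sub>m m n)" for \<tau>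
    using mc_sem_no_positions[OF substochastic_induced_chain[OF assms(1)], of \<tau>] assms(2) by simp
  then show ?thesis
    by (simp add: romdp_sem_def)
qed

lemma substochastic_id: "substochastic_mdp n n (romdp_id n)"
  by (auto simp: substochastic_mdp_def romdp_id_def)

lemma substochastic_swap: "substochastic_mdp (m + n) (n + m) (romdp_swap m n)"
  by (auto simp: substochastic_mdp_def romdp_swap_def)

lemma romdp_sem_id: "romdp_sem (romdp_id n :: ('q, 'a) romdp) = {mc_id n}"
proof -
  have "mat n n (\<lambda>(i, j). of_bool (entry (romdp_id n :: ('q, 'a) romdp) i = Inr j)) = (1\<^sub>m n :: real mat)"
    by (rule eq_matI) (auto simp: romdp_id_def)
  moreover have "positions (romdp_id n :: ('q, 'a) romdp) = {}"
    by (simp add: romdp_id_def)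
  ultimately show ?thesis
    by (simp add: romdp_sem_no_positions[OF substochastic_id] mc_id_def)
qed

lemma romdp_sem_swap: "romdp_sem (romdp_swap m n :: ('q, 'a) romdp) = {mc_swap m n}"
proof -
  have "mat (m + n) (n + m) (\<lambda>(i, j). of_bool (entry (romdp_swap m n :: ('q, 'a) romdp) i = Inr j))
      = fst (mc_swap m n)"
    by (rule eq_matI) (auto simp: romdp_swap_def mc_swap_def)
  moreover have "positions (romdp_swap m n :: ('q, 'a) romdp) = {}"
    by (simp add: romdp_swap_def)
  ultimately show ?thesis
    by (simp add: romdp_sem_no_positions[OF substochastic_swap] mc_swap_def)
qed

section \<open>Sequential composition\<close>

lemma romdp_comp_simps [simp]:
  "ins (romdp_comp A B) = ins A" "outs (romdp_comp A B) = outs B"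
  "positions (romdp_comp A B) = positions A <+> positions B"
  "reward (romdp_comp A B) = case_sum (reward A) (reward B)"
  "entry (romdp_comp A B) i = (case entry A i of
      Inl s \<Rightarrow> Inl (Inl s) | Inr k \<Rightarrow> map_sum Inr id (entry B k))"
  "tprob (romdp_comp A B) (Inl s) a (Inl (Inl s')) = tprob A s a (Inl s')"
  "tprob (romdp_comp A B) (Inl s) a (Inl (Inr u))
     = (\<Sum>i<outs A. tprob A s a (Inr i) * of_bool (entry B i = Inl u))"
  "tprob (romdp_comp A B) (Inl s) a (Inr j)
     = (\<Sum>i<outs A. tprob A s a (Inr i) * of_bool (entry B i = Inr j))"
  "tprob (romdp_comp A B) (Inr u) a (Inl (Inl s')) = 0"
  "tprob (romdp_comp A B) (Inr u) a (Inl (Inr u')) = tprob B u a (Inl u')"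
  "tprob (romdp_comp A B) (Inr u) a (Inr j) = tprob B u a (Inr j)"
  by (simp_all add: romdp_comp_def)

lemma sum_of_bool_eq:
  assumes "finite T" "t \<in> T"
  shows "(\<Sum>x\<in>T. of_bool (t = x)) = (1 :: real)"
  using assms by (simp add: of_bool_def)

lemma substochastic_comp:
  assumes A: "substochastic_mdp m k A" and B: "substochastic_mdp k n B"
  shows "substochastic_mdp m n (romdp_comp A B)"
proof -
  note DA = substochastic_mdpD[OF A] and DB = substochastic_mdpD[OF B]
  let ?C = "romdp_comp A B"
  have fin: "finite (positions ?C)" using DA DB by simp
  have "entry ?C i \<in> targets ?C" if "i < m" for i
  proof (cases "entry A i")
    case (Inr j)
    then show ?thesis
      using DA(2) DA(4)[OF that] DB(2) DB(4)[of j] by (cases "entry B j") auto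
  qed (use DA(4)[OF that] in auto)
  moreover have "tprob ?C x a t \<ge> 0" if "x \<in> positions ?C" "t \<in> targets ?C" for x a t
    using that DA(2,5) DB(2,5)
    by (cases x; cases t; cases "projl t") (auto intro!: sum_nonneg)
  moreover have "(\<Sum>t\<in>targets ?C. tprob ?C x a t) \<le> 1" if "x \<in> positions ?C" for x a
  proof (cases x)
    case (Inl s)
    then have s: "s \<in> positions A" using that by auto
    have "(\<Sum>t\<in>targets ?C. tprob ?C x a t)
        = (\<Sum>s'\<in>positions A. tprob A s a (Inl s')) +
          (\<Sum>t\<in>targets B. \<Sum>i<k. tprob A s a (Inr i) * of_bool (entry B i = t))"
      using DA DB Inl by (simp add: sum_targets[OF fin] sum_targets[OF DB(3)] sum.Plus)
    also have "(\<Sum>t\<in>targets B. \<Sum>i<k. tprob A s a (Inr i) * of_bool (entry B i = t))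
        = (\<Sum>i<k. tprob A s a (Inr i) * (\<Sum>t\<in>targets B. of_bool (entry B i = t)))"
      by (subst sum.swap) (simp add: sum_distrib_left)
    also have "\<dots> = (\<Sum>i<k. tprob A s a (Inr i))"
      using DB(3,4) by (intro sum.cong refl) (subst sum_of_bool_eq, auto simp: targets_def)
    finally show ?thesis
      using DA(2) DA(6)[OF s, of a] by (simp add: sum_targets[OF DA(3)])
  next
    case (Inr u)
    then have "(\<Sum>t\<in>targets ?C. tprob ?C x a t) = (\<Sum>t\<in>targets B. tprob B u a t)"
      using DA(3) DB by (simp add: sum_targets[OF fin] sum_targets[OF DB(3)] sum.Plus)
    then show ?thesis using DB(6)[of u a] that Inr by auto
  qed
  ultimately show ?thesis
    using DA DB unfolding substochastic_mdp_def by (auto simp del: romdp_comp_simps(5-))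
qed

text \<open>A path of the composite runs through \<open>A\<close>, crosses one of the
  \<open>k\<close> wires, and then stays in \<open>B\<close>. The sum is over the wire and the level
  on which it is crossed.\<close>

lemma chain_sem_comp:
  fixes A :: "('q, unit) romdp" and B :: "('r, unit) romdp"
  assumes A: "substochastic_mdp m k A" and B: "substochastic_mdp k n B" and i: "i < m"
  shows "chain_sem (romdp_comp A B) (Inr i, b) (Inr j, True)
       = (\<Sum>p\<in>{..<k} \<times> UNIV. chain_sem A (Inr i, b) (Inr (fst p), snd p) *
                              chain_sem B (Inr (fst p), snd p) (Inr j, True))"
proof -
  note DA = substochastic_mdpD[OF A] and DB = substochastic_mdpD[OF B]
  let ?C = "romdp_comp A B" and ?y = "(Inr j, True)"
  define W where "W = node_weight ?C"
  define fA :: "'q node \<Rightarrow> ('q + 'r) node" where "fA = map_prod (map_sum Inl id) id"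
  define fB :: "'r node \<Rightarrow> ('q + 'r) node" where "fB = map_prod (map_sum Inr id) id"
  have fA [simp]: "fA (Inl s, c) = (Inl (Inl s), c)" "fA (Inr e, c) = (Inr e, c)" for s e c
    by (simp_all add: fA_def)
  have fB [simp]: "fB (Inl s, c) = (Inl (Inr s), c)" "fB (Inr e, c) = (Inr e, c)" for s e c
    by (simp_all add: fB_def)
  have inj: "inj_on fA (nodes A)" "inj_on fB (nodes B)"
    by (auto simp: inj_on_def nodes_def)
  have nodes: "nodes ?C = fA ` nodes A \<union> fB ` nodes B"
    by (auto simp: nodes_def fA_def fB_def image_iff)
  have disj: "fA ` nodes A \<inter> fB ` nodes B = {}"
    by (auto simp: nodes_def)
  have fin: "finite (nodes A)" "finite (nodes B)"
    using DA(3) DB(3) by (auto intro: finite_nodes)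
  define v where "v = path_sum (nodes ?C) W (\<lambda>z. W z ?y)"
  \<comment> \<open>Nothing leads back from the second component, so on its positions the composite
    is evaluated by \<open>B\<close> alone.\<close>
  have vB: "v (fB x) = chain_sem B x ?y" if "x \<in> nodes B" for x
    unfolding v_def chain_sem_def
  proof (rule path_sum_embed)
    show "W (fB x') z = 0" if "x' \<in> insert x (nodes B)" "z \<in> nodes ?C - fB ` nodes B" for x' z
      using that \<open>x \<in> nodes B\<close> unfolding nodes by (auto simp: W_def nodes_def)
  qed (use that inj fin in \<open>auto simp: nodes W_def\<close>, auto simp: nodes_def)
  \<comment> \<open>A crossing edge is an edge to an exit of \<open>A\<close> continued from the
    entrance of \<open>B\<close> with that number. Entrances keep the level, so only the summand
    with the level of \<open>y\<close> survives. As \<open>fB\<close> fixes exits, an exit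
    \<open>y\<close> is covered too.\<close>
  have W_out: "W (fA x) (fB y)
      = (\<Sum>p\<in>{..<k} \<times> UNIV. node_weight A x (Inr (fst p), snd p) * node_weight B (Inr (fst p), snd p) y)"
    if x: "x \<in> insert (Inr i, b) (nodes A)" for x y
  proof -
    obtain t c where y: "y = (t, c)" by force
    have "W (fA x) (fB y) = (\<Sum>l<k. node_weight A x (Inr l, c) * of_bool (entry B l = t))"
    proof (cases "x \<in> nodes A")
      case True
      then obtain s d where s: "x = (Inl s, d)" "s \<in> positions A" by (auto simp: nodes_def)
      have "tprob ?C (Inl s) () (map_sum Inr id t)
          = (\<Sum>l<k. tprob A s () (Inr l) * of_bool (entry B l = t))"
        by (cases t) (simp_all add: DA(2))
      moreover have "ennreal \<dots> = (\<Sum>l<k. ennreal (tprob A s () (Inr l)) * of_bool (entry B l = t))"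
        using DA(2,5) s(2) by (subst sum_ennreal[symmetric]) (auto simp: of_bool_def intro!: sum.cong)
      ultimately have "W (fA x) (fB y)
          = (\<Sum>l<k. ennreal (tprob A s () (Inr l)) * of_bool (entry B l = t)) * dual_coeff (reward A s) d c"
        by (simp add: s y W_def fB_def del: sum_mult_of_bool_eq)
      then show ?thesis
        unfolding sum_distrib_right by (simp add: s ac_simps del: sum_mult_of_bool_eq sum_of_bool_mult_eq)
    next
      case False
      then have xi: "x = (Inr i, b)" using x by simp
      show ?thesis
      proof (cases "entry A i")
        case (Inl s)
        then show ?thesis by (cases t) (simp_all add: xi y W_def)
      next
        case (Inr l)
        then have "l < k" using DA(2) DA(4)[OF i] by simp
        have "map_sum Inr id t' = map_sum Inr id t \<longleftrightarrow> t' = t" for t' :: "'r + nat"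
          by (cases t; cases t') auto
        with Inr show ?thesis
          using \<open>l < k\<close> by (auto simp: xi y W_def fB_def of_bool_mult_eq_if if_distrib cong: if_cong)
      qed
    qed
    also have "\<dots> = (\<Sum>l<k. \<Sum>d\<in>UNIV. node_weight A x (Inr l, d) * node_weight B (Inr l, d) y)"
      by (cases c) (simp_all add: y UNIV_bool del: sum_mult_of_bool_eq)
    finally show ?thesis
      by (simp add: sum.cartesian_product case_prod_unfold)
  qed
  \<comment> \<open>Seen from \<open>A\<close>, leaving by an exit has the value of the
    corresponding entrance of \<open>B\<close>, whether that entrance leads to a position or
    directly to an exit.\<close>
  have boundary: "W (fA x) ?y + path_step (fB ` nodes B) W v (fA x)
      = (\<Sum>p\<in>{..<k} \<times> UNIV. node_weight A x (Inr (fst p), snd p) *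
                              chain_sem B (Inr (fst p), snd p) ?y)"
    if x: "x \<in> insert (Inr i, b) (nodes A)" for x
  proof -
    have "path_step (fB ` nodes B) W v (fA x) = (\<Sum>z\<in>nodes B. W (fA x) (fB z) * chain_sem B z ?y)"
      unfolding path_step_def by (simp add: sum.reindex[OF inj(2)] vB)
    also have "\<dots> = (\<Sum>p\<in>{..<k} \<times> UNIV. node_weight A x (Inr (fst p), snd p) *
        path_step (nodes B) (node_weight B) (\<lambda>z. chain_sem B z ?y) (Inr (fst p), snd p))"
      unfolding W_out[OF x] path_step_def sum_distrib_right sum_distrib_left
      by (subst sum.swap) (simp add: mult.assoc)
    finally show ?thesis
      using W_out[OF x, of ?y]
      by (subst chain_sem_unfold) (simp only: fB distrib_left sum.distrib)
  qed
  have "v (fA (Inr i, b))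
      = path_sum (fA ` nodes A) W (\<lambda>y. W y ?y + path_step (fB ` nodes B) W v y) (fA (Inr i, b))"
    unfolding v_def nodes using fin disj by (intro path_sum_restrict) auto
  also have "\<dots> = path_sum (nodes A) (node_weight A) (\<lambda>x. \<Sum>p\<in>{..<k} \<times> UNIV.
      node_weight A x (Inr (fst p), snd p) * chain_sem B (Inr (fst p), snd p) ?y) (Inr i, b)"
  proof (rule path_sum_embed)
    show "W (fA x) (fA y) = node_weight A x y"
      if "x \<in> insert (Inr i, b) (nodes A)" "y \<in> nodes A" for x y
    proof -
      have "map_sum Inr id t \<noteq> Inl (Inl s)" for t :: "'r + nat" and s :: 'q by (cases t) auto
      then show ?thesis using that by (auto simp: nodes_def W_def split: sum.split)
    qed
  qed (use fin inj boundary in auto)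
  also have "\<dots> = (\<Sum>p\<in>{..<k} \<times> UNIV. chain_sem A (Inr i, b) (Inr (fst p), snd p) *
                              chain_sem B (Inr (fst p), snd p) (Inr j, True))"
    unfolding path_sum_linear by (simp add: chain_sem_def)
  finally show ?thesis
    by (simp add: v_def chain_sem_def W_def)
qed

lemma enn2real_add:
  assumes "a \<noteq> top_class.top" "b \<noteq> top_class.top"
  shows "enn2real (a + b) = enn2real a + enn2real b"
  using assms by (cases a; cases b) (auto simp flip: ennreal_plus)

lemma enn2real_sum:
  assumes "\<And>i. i \<in> I \<Longrightarrow> f i \<noteq> top_class.top"
  shows "enn2real (\<Sum>i\<in>I. f i) = (\<Sum>i\<in>I. enn2real (f i))"
  using assms
  by (induction I rule: infinite_finite_induct) (auto simp: enn2real_add less_top)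

text \<open>Starting on level \<open>True\<close> only one crossing level contributes. Starting on
  \<open>False\<close> both do, which gives the two terms of the product rule for rewards.\<close>

lemma mc_sem_comp:
  assumes A: "substochastic_mdp m k A" and B: "substochastic_mdp k n B"
  shows "mc_sem (romdp_comp A B) = mc_comp (mc_sem A) (mc_sem B)"
proof -
  let ?a = "\<lambda>i b j. chain_sem A (Inr i, b) (Inr j, True)"
  let ?b = "\<lambda>i b j. chain_sem B (Inr i, b) (Inr j, True)"
  have fin: "?a i c l * ?b l d j \<noteq> top_class.top" if "i < m" "j < n" "l < k" for i j l c d
    using chain_sem_finite[OF A that(1,3), of c] chain_sem_finite[OF B that(3,2), of d]
    by (auto simp: ennreal_mult_eq_top_iff)
  have T: "enn2real (chain_sem (romdp_comp A B) (Inr i, True) (Inr j, True))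
      = (\<Sum>l<k. enn2real (?a i True l) * enn2real (?b l True j))" if "i < m" "j < n" for i j
  proof -
    have "chain_sem (romdp_comp A B) (Inr i, True) (Inr j, True) = (\<Sum>l<k. ?a i True l * ?b l True j)"
      unfolding chain_sem_comp[OF A B that(1)] sum.cartesian_product'
      by (simp add: UNIV_bool chain_sem_levels)
    also have "enn2real \<dots> = (\<Sum>l<k. enn2real (?a i True l * ?b l True j))"
      using fin[OF that] by (intro enn2real_sum) auto
    finally show ?thesis by (simp add: enn2real_mult)
  qed
  have F: "enn2real (chain_sem (romdp_comp A B) (Inr i, False) (Inr j, True))
      = (\<Sum>l<k. enn2real (?a i True l) * enn2real (?b l False j))
        + (\<Sum>l<k. enn2real (?a i False l) * enn2real (?b l True j))" if "i < m" "j < n" for i j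
  proof -
    have "chain_sem (romdp_comp A B) (Inr i, False) (Inr j, True)
        = (\<Sum>l<k. ?a i True l * ?b l False j) + (\<Sum>l<k. ?a i False l * ?b l True j)"
      unfolding chain_sem_comp[OF A B that(1)] sum.cartesian_product'
      by (simp add: UNIV_bool chain_sem_levels sum.distrib)
    also have "enn2real \<dots> = enn2real (\<Sum>l<k. ?a i True l * ?b l False j)
        + enn2real (\<Sum>l<k. ?a i False l * ?b l True j)"
      using fin[OF that] by (intro enn2real_add) (auto simp: less_top)
    also have "\<dots> = (\<Sum>l<k. enn2real (?a i True l * ?b l False j))
        + (\<Sum>l<k. enn2real (?a i False l * ?b l True j))"
      using fin[OF that] by (intro arg_cong2[where f = "(+)"] enn2real_sum) auto
    finally show ?thesis by (simp add: enn2real_mult)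
  qed
  show ?thesis
    unfolding mc_sem_eq[OF A] mc_sem_eq[OF B] mc_sem_eq[OF substochastic_comp[OF A B]] mc_comp_def
    by (auto simp: T F scalar_prod_def lessThan_atLeast0 intro!: eq_matI)
qed

section \<open>Sums\<close>

lemma romdp_sum_simps [simp]:
  "ins (romdp_sum A B) = ins A + ins B" "outs (romdp_sum A B) = outs A + outs B"
  "positions (romdp_sum A B) = positions A <+> positions B"
  "reward (romdp_sum A B) = case_sum (reward A) (reward B)"
  "entry (romdp_sum A B) i = (if i < ins A then map_sum Inl id (entry A i)
     else map_sum Inr (\<lambda>j. j + outs A) (entry B (i - ins A)))"
  "tprob (romdp_sum A B) (Inl s) a (Inl (Inl s')) = tprob A s a (Inl s')"
  "tprob (romdp_sum A B) (Inl s) a (Inl (Inr u)) = 0"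
  "tprob (romdp_sum A B) (Inl s) a (Inr j) = (if j < outs A then tprob A s a (Inr j) else 0)"
  "tprob (romdp_sum A B) (Inr u) a (Inl (Inl s')) = 0"
  "tprob (romdp_sum A B) (Inr u) a (Inl (Inr u')) = tprob B u a (Inl u')"
  "tprob (romdp_sum A B) (Inr u) a (Inr j) = (if j < outs A then 0 else tprob B u a (Inr (j - outs A)))"
  by (simp_all add: romdp_sum_def)

lemma sum_lessThan_add:
  fixes f :: "nat \<Rightarrow> 'b :: comm_monoid_add"
  shows "(\<Sum>j<m + n. f j) = (\<Sum>j<m. f j) + (\<Sum>j<n. f (j + m))"
  by (induction n) (simp_all add: ac_simps)

lemma substochastic_sum:
  assumes A: "substochastic_mdp m n A" and B: "substochastic_mdp m' n' B"
  shows "substochastic_mdp (m + m') (n + n') (romdp_sum A B)"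
proof -
  note DA = substochastic_mdpD[OF A] and DB = substochastic_mdpD[OF B]
  let ?C = "romdp_sum A B"
  have fin: "finite (positions ?C)" using DA(3) DB(3) by simp
  have "entry ?C i \<in> targets ?C" if "i < m + m'" for i
    using that DA(1,2) DA(4)[of i] DB(2) DB(4)[of "i - m"]
    by (cases "i < m"; cases "entry A i"; cases "entry B (i - m)") auto
  moreover have "tprob ?C x a t \<ge> 0" if "x \<in> positions ?C" "t \<in> targets ?C" for x a t
    using that DA(2,5) DB(2,5) by (cases x; cases t; cases "projl t") auto
  moreover have "(\<Sum>t\<in>targets ?C. tprob ?C x a t) \<le> 1" if "x \<in> positions ?C" for x a
  proof (cases x)
    case (Inl s)
    then have "(\<Sum>t\<in>targets ?C. tprob ?C x a t) = (\<Sum>t\<in>targets A. tprob A s a t)"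
      using DA(3) DB(3) by (simp add: sum_targets[OF fin] sum_targets[OF DA(3)] sum.Plus sum_lessThan_add)
    then show ?thesis using DA(6)[of s a] that Inl by auto
  next
    case (Inr u)
    then have "(\<Sum>t\<in>targets ?C. tprob ?C x a t) = (\<Sum>t\<in>targets B. tprob B u a t)"
      using DA(3) DB(3) by (simp add: sum_targets[OF fin] sum_targets[OF DB(3)] sum.Plus sum_lessThan_add)
    then show ?thesis using DB(6)[of u a] that Inr by auto
  qed
  moreover have "reward ?C x \<ge> 0" if "x \<in> positions ?C" for x
    using that DA(7) DB(7) by auto
  ultimately show ?thesis
    using fin DA(1,2) DB(1,2) unfolding substochastic_mdp_def by (simp del: romdp_sum_simps(3-))
qed

lemma chain_sem_sum_left:
  fixes A :: "('q, unit) romdp" and B :: "('r, unit) romdp"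
  assumes A: "substochastic_mdp m n A" and B: "substochastic_mdp m' n' B" and i: "i < m"
  shows "chain_sem (romdp_sum A B) (Inr i, b) (Inr j, True)
       = (if j < n then chain_sem A (Inr i, b) (Inr j, True) else 0)"
proof -
  note DA = substochastic_mdpD[OF A] and DB = substochastic_mdpD[OF B]
  define f :: "'q node \<Rightarrow> ('q + 'r) node" where "f = map_prod (map_sum Inl id) id"
  have f [simp]: "f (Inl s, c) = (Inl (Inl s), c)" "f (Inr e, c) = (Inr e, c)" for s e c
    by (simp_all add: f_def)
  have e: "map_sum Inl id t = (Inl (Inl s) :: ('q + 'r) + nat) \<longleftrightarrow> t = Inl s"
    "map_sum Inl id t \<noteq> (Inl (Inr u) :: ('q + 'r) + nat)"
    "map_sum Inl id t = (Inr l :: ('q + 'r) + nat) \<longleftrightarrow> t = Inr l"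
    for t :: "'q + nat" and s u l
    by (cases t; auto)+
  \<comment> \<open>The case distinction on \<open>j < n\<close> is put into the constant term as a
    scalar factor, which \<open>path_sum_cmult\<close> can extract.\<close>
  have "chain_sem (romdp_sum A B) (f (Inr i, b)) (Inr j, True)
      = path_sum (nodes A) (node_weight A)
          (\<lambda>x. (if j < n then 1 else 0) * node_weight A x (Inr j, True)) (Inr i, b)"
    unfolding chain_sem_def
  proof (rule path_sum_embed)
    show "finite (nodes (romdp_sum A B))"
      using DA(3) DB(3) by (intro finite_nodes) simp
    show "inj_on f (nodes A)" "f ` nodes A \<subseteq> nodes (romdp_sum A B)"
      by (auto simp: inj_on_def nodes_def)
    show "node_weight (romdp_sum A B) (f x) (f y) = node_weight A x y"
      if "x \<in> insert (Inr i, b) (nodes A)" "y \<in> nodes A" for x y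
      using that i DA(1) by (auto simp: nodes_def e)
    show "node_weight (romdp_sum A B) (f x) z = 0"
      if "x \<in> insert (Inr i, b) (nodes A)" "z \<in> nodes (romdp_sum A B) - f ` nodes A" for x z
      using that i DA(1) by (force simp: nodes_def e)
    show "node_weight (romdp_sum A B) (f x) (Inr j, True)
        = (if j < n then 1 else 0) * node_weight A x (Inr j, True)"
      if "x \<in> insert (Inr i, b) (nodes A)" for x
      using that i DA(1,2) DA(4)[OF i] by (auto simp: nodes_def e)
  qed
  then show ?thesis
    by (simp add: path_sum_cmult chain_sem_def)
qed

lemma chain_sem_sum_right:
  fixes A :: "('q, unit) romdp" and B :: "('r, unit) romdp"
  assumes A: "substochastic_mdp m n A" and B: "substochastic_mdp m' n' B" and i: "i < m'"
  shows "chain_sem (romdp_sum A B) (Inr (i + m), b) (Inr j, True)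
       = (if j < n then 0 else chain_sem B (Inr i, b) (Inr (j - n), True))"
proof -
  note DA = substochastic_mdpD[OF A] and DB = substochastic_mdpD[OF B]
  \<comment> \<open>As a source, \<open>Inr e\<close> is an entrance, so the shift is by
    \<open>m\<close>; the shift of exits by \<open>n\<close> is accounted for in the constant
    term.\<close>
  define f :: "'r node \<Rightarrow> ('q + 'r) node" where "f = map_prod (map_sum Inr (\<lambda>i. i + m)) id"
  have f [simp]: "f (Inl s, c) = (Inl (Inr s), c)" "f (Inr e, c) = (Inr (e + m), c)" for s e c
    by (simp_all add: f_def)
  have e: "map_sum Inr g t = (Inl (Inr s) :: ('q + 'r) + nat) \<longleftrightarrow> t = Inl s"
    "map_sum Inr g t \<noteq> (Inl (Inl u) :: ('q + 'r) + nat)"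
    "map_sum Inr (\<lambda>j. j + k) t = (Inr l :: ('q + 'r) + nat) \<longleftrightarrow> k \<le> l \<and> t = Inr (l - k)"
    for t :: "'r + nat" and s u l k g
    by (cases t; auto)+
  \<comment> \<open>For \<open>j < n\<close> the truncated difference \<open>j - n\<close> is 0, and
    the factor 0 discards the value of \<open>B\<close> at that exit.\<close>
  have "chain_sem (romdp_sum A B) (f (Inr i, b)) (Inr j, True)
      = path_sum (nodes B) (node_weight B)
          (\<lambda>x. (if j < n then 0 else 1) * node_weight B x (Inr (j - n), True)) (Inr i, b)"
    unfolding chain_sem_def
  proof (rule path_sum_embed)
    show "finite (nodes (romdp_sum A B))"
      using DA(3) DB(3) by (intro finite_nodes) simp
    show "inj_on f (nodes B)" "f ` nodes B \<subseteq> nodes (romdp_sum A B)"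
      by (auto simp: inj_on_def nodes_def)
    show "node_weight (romdp_sum A B) (f x) (f y) = node_weight B x y"
      if "x \<in> insert (Inr i, b) (nodes B)" "y \<in> nodes B" for x y
      using that i DA(1) by (auto simp: nodes_def e)
    show "node_weight (romdp_sum A B) (f x) z = 0"
      if "x \<in> insert (Inr i, b) (nodes B)" "z \<in> nodes (romdp_sum A B) - f ` nodes B" for x z
      using that i DA(1) by (force simp: nodes_def e)
    show "node_weight (romdp_sum A B) (f x) (Inr j, True)
        = (if j < n then 0 else 1) * node_weight B x (Inr (j - n), True)"
      if "x \<in> insert (Inr i, b) (nodes B)" for x
      using that i DA(1,2) by (auto simp: nodes_def e)
  qed
  then show ?thesis
    by (simp add: path_sum_cmult chain_sem_def)
qed

lemma mc_sem_sum:
  assumes A: "substochastic_mdp m n A" and B: "substochastic_mdp m' n' B"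
  shows "mc_sem (romdp_sum A B) = mc_sum (mc_sem A) (mc_sem B)"
proof -
  have blocks: "mat (m + m') (n + n')
      (\<lambda>(i, j). enn2real (chain_sem (romdp_sum A B) (Inr i, b) (Inr j, True)))
    = block_diag (mat m n (\<lambda>(i, j). enn2real (chain_sem A (Inr i, b) (Inr j, True))))
        (mat m' n' (\<lambda>(i, j). enn2real (chain_sem B (Inr i, b) (Inr j, True))))" for b
  proof (rule eq_matI)
    fix i j
    assume "i < dim_row (block_diag (mat m n (\<lambda>(i, j). enn2real (chain_sem A (Inr i, b) (Inr j, True))))
        (mat m' n' (\<lambda>(i, j). enn2real (chain_sem B (Inr i, b) (Inr j, True)))))"
      and "j < dim_col (block_diag (mat m n (\<lambda>(i, j). enn2real (chain_sem A (Inr i, b) (Inr j, True))))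
        (mat m' n' (\<lambda>(i, j). enn2real (chain_sem B (Inr i, b) (Inr j, True)))))"
    then have ij: "i < m + m'" "j < n + n'" by (auto simp: block_diag_def)
    show "mat (m + m') (n + n')
          (\<lambda>(i, j). enn2real (chain_sem (romdp_sum A B) (Inr i, b) (Inr j, True))) $$ (i, j)
        = block_diag (mat m n (\<lambda>(i, j). enn2real (chain_sem A (Inr i, b) (Inr j, True))))
        (mat m' n' (\<lambda>(i, j). enn2real (chain_sem B (Inr i, b) (Inr j, True)))) $$ (i, j)"
    proof (cases "i < m")
      case True
      then show ?thesis
        using ij chain_sem_sum_left[OF A B True, of b j] by (auto simp: block_diag_def)
    next
      case False
      then have "i - m < m'" "i - m + m = i" using ij by auto
      then show ?thesis
        using ij False chain_sem_sum_right[OF A B, of "i - m" b j] by (auto simp: block_diag_def)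
    qed
  qed (auto simp: block_diag_def)
  show ?thesis
    unfolding mc_sem_eq[OF A] mc_sem_eq[OF B] mc_sem_eq[OF substochastic_sum[OF A B]] mc_sum_def
    by (simp add: blocks)
qed

section \<open>Traces\<close>

lemma leads_to_iff:
  "leads_to l e i t \<longleftrightarrow>
     e i \<notin> Inr ` {..<l} \<and> t = e i \<or> (\<exists>j<l. e i = Inr j \<and> leads_to l e j t)"
  by (subst leads_to.simps) auto

lemma leads_to_unique: "leads_to l e i t \<Longrightarrow> leads_to l e i u \<Longrightarrow> t = u"
proof (induction rule: leads_to.induct)
  case (stop i)
  from stop.prems stop.hyps show ?case by (subst (asm) leads_to_iff) auto
next
  case (step i j t)
  from step.prems have "leads_to l e j u"
    using step.hyps by (subst (asm) leads_to_iff) auto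
  then show ?case by (rule step.IH)
qed

lemma leads_to_not_wire: "leads_to l e i t \<Longrightarrow> t \<notin> Inr ` {..<l}"
  by (induction rule: leads_to.induct) auto

lemma leads_to_closed:
  assumes "leads_to l e i t" "i < N" "l \<le> N" and "\<And>i. i < N \<Longrightarrow> e i \<in> T"
  shows "t \<in> T"
  using assms by (induction rule: leads_to.induct) auto

text \<open>
  If the chain of \<open>i \<ge> l\<close> did not stop, then \<open>e\<close> would map \<open>i\<close> and the \<open>j < l\<close> whose chain does not
  stop injectively to the latter.
\<close>

lemma leads_to_exists:
  fixes e :: "nat \<Rightarrow> 'q + nat"
  assumes i: "l \<le> i" "i < N"
    and inj: "\<And>i i' j. i < N \<Longrightarrow> i' < N \<Longrightarrow> e i = Inr j \<Longrightarrow> e i' = Inr j \<Longrightarrow> i = i'"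
  shows "\<exists>t. leads_to l e i t"
proof (rule ccontr)
  assume no: "\<nexists>t. leads_to l e i t"
  define S where "S = {j. j < l \<and> (\<nexists>t. leads_to l e j t)}"
  have next_S: "\<exists>j\<in>S. e k = Inr j" if k: "k \<in> insert i S" for k
  proof -
    have nk: "\<nexists>t. leads_to l e k t" using k no by (auto simp: S_def)
    then have "e k \<in> Inr ` {..<l}" using leads_to.stop[of e k l] by blast
    then obtain j where j: "j < l" "e k = Inr j" by auto
    then have "\<nexists>t. leads_to l e j t" using nk leads_to.step[of e k j l] by blast
    with j show ?thesis by (auto simp: S_def)
  qed
  have N: "k < N" if "k \<in> insert i S" for k
    using that i by (auto simp: S_def)
  define g where "g k = projr (e k)" for k
  have g: "e k = Inr (g k)" "g k \<in> S" if "k \<in> insert i S" for k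
    using next_S[OF that] by (auto simp: g_def)
  have "inj_on g (insert i S)"
    using inj N g by (intro inj_onI) metis
  moreover have "finite S" by (simp add: S_def)
  ultimately have "card (insert i S) \<le> card S"
    using g by (intro card_inj_on_le[of g]) auto
  moreover have "i \<notin> S" using i by (simp add: S_def)
  ultimately show False using \<open>finite S\<close> by simp
qed

text \<open>Reads a target of the traced MDP as a target of the original one; the image avoids the
  fed back exits.\<close>

definition unshift :: "nat \<Rightarrow> 'q + nat \<Rightarrow> 'q + nat" where
  "unshift l = map_sum id (\<lambda>j. j + l)"

lemma unshift_simps [simp]: "unshift l (Inl s) = Inl s" "unshift l (Inr j) = Inr (j + l)"
  by (simp_all add: unshift_def)

lemma unshift_eq_iff [simp]: "unshift l t = unshift l u \<longleftrightarrow> t = u"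
  by (cases t; cases u) auto

lemma unshift_not_wire: "unshift l t \<notin> Inr ` {..<l}"
  by (cases t) auto

lemma romdp_trace_simps [simp]:
  "ins (romdp_trace l m n E) = m" "outs (romdp_trace l m n E) = n"
  "positions (romdp_trace l m n E) = positions E" "reward (romdp_trace l m n E) = reward E"
  "tprob (romdp_trace l m n E) q a t
     = tprob E q a (unshift l t) + (\<Sum>i\<in>prec l E (unshift l t). tprob E q a (Inr i))"
  by (simp_all add: romdp_trace_def split: sum.split)

text \<open>\<open>unique_wire\<close> makes the chain of every remaining entrance stop, so that the
  definite description in \<open>romdp_trace\<close> is meaningful. Both assumptions pass to induced
  chains.\<close>

locale traceable =
  fixes l m n :: nat and E :: "('q, 'a) romdp"
  assumes substochastic: "substochastic_mdp (l + m) (l + n) E"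
    and unique_wire: "\<And>i i' j. i < l + m \<Longrightarrow> i' < l + m \<Longrightarrow>
      entry E i = Inr j \<Longrightarrow> entry E i' = Inr j \<Longrightarrow> i = i'"
begin

lemmas D = substochastic_mdpD[OF substochastic]

lemma entry_trace:
  assumes "i < m"
  shows "leads_to l (entry E) (i + l) (unshift l (entry (romdp_trace l m n E) i))"
proof -
  obtain t where t: "leads_to l (entry E) (i + l) t"
    using leads_to_exists[of l "i + l" "l + m" "entry E"] assms unique_wire by auto
  have "(THE t. leads_to l (entry E) (i + l) t) = t"
    using t leads_to_unique by blast
  moreover have "unshift l (map_sum id (\<lambda>t. t - l) t) = t"
    using leads_to_not_wire[OF t] by (cases t) (auto simp: image_iff)
  ultimately show ?thesis
    using t by (simp add: romdp_trace_def)
qed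

lemma entry_trace_eq_iff:
  assumes "i < m"
  shows "entry (romdp_trace l m n E) i = t \<longleftrightarrow> leads_to l (entry E) (i + l) (unshift l t)"
  using entry_trace[OF assms] leads_to_unique unshift_eq_iff by metis

text \<open>A chain of wires stops in at most one place, so the sets \<open>prec\<close> of
  different targets are disjoint. Cyclic wires belong to none of them; probability entering a cycle
  is lost, which leaves an inequality.\<close>

lemma substochastic_trace: "substochastic_mdp m n (romdp_trace l m n E)"
proof -
  let ?T = "romdp_trace l m n E"
  have un: "unshift l t \<in> targets E \<longleftrightarrow> t \<in> targets ?T" for t
    using D(2) by (cases t) auto
  have prec: "i < l" "i < outs E" if "i \<in> prec l E t" for i t
    using that D(2) by (auto simp: prec_def)
  have "entry ?T i \<in> targets ?T" if "i < m" for i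
    using leads_to_closed[OF entry_trace[OF that], of "l + m" "targets E"] that D(4) un by auto
  moreover have "tprob ?T s a t \<ge> 0" if "s \<in> positions ?T" "t \<in> targets ?T" for s a t
  proof -
    have "tprob E s a (unshift l t) \<ge> 0" using that un by (intro D(5)) auto
    moreover have "(\<Sum>i\<in>prec l E (unshift l t). tprob E s a (Inr i)) \<ge> 0"
      using that prec by (intro sum_nonneg D(5)) auto
    ultimately show ?thesis by simp
  qed
  moreover have "(\<Sum>t\<in>targets ?T. tprob ?T s a t) \<le> 1" if s: "s \<in> positions ?T" for s a
  proof -
    have fin: "finite (targets ?T)" using D(3) by (simp add: targets_def)
    have fin_prec: "finite (prec l E t)" for t by (simp add: prec_def)
    have disj: "prec l E (unshift l t) \<inter> prec l E (unshift l u) = {}" if "t \<noteq> u" for t u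
      using leads_to_unique[of l "entry E" _ "unshift l t" "unshift l u"] that
      by (auto simp: prec_def)
    have "(\<Sum>t\<in>targets ?T. \<Sum>i\<in>prec l E (unshift l t). tprob E s a (Inr i))
        = (\<Sum>i\<in>(\<Union>t\<in>targets ?T. prec l E (unshift l t)). tprob E s a (Inr i))"
      using fin fin_prec disj by (intro sum.UNION_disjoint[symmetric]) auto
    also have "\<dots> \<le> (\<Sum>i<l. tprob E s a (Inr i))"
      using s prec D(2) by (intro sum_mono2 D(5)) auto
    finally have "(\<Sum>t\<in>targets ?T. tprob ?T s a t)
        \<le> (\<Sum>t\<in>targets ?T. tprob E s a (unshift l t)) + (\<Sum>i<l. tprob E s a (Inr i))"
      by (simp add: sum.distrib)
    also have "\<dots> = (\<Sum>t\<in>targets E. tprob E s a t)"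
      using D(2,3) by (simp add: sum_targets sum_lessThan_add)
    finally show ?thesis using D(6)[of s a] s by simp
  qed
  ultimately show ?thesis
    using D(3,7) unfolding substochastic_mdp_def by (simp del: romdp_trace_simps(5))
qed

end

section \<open>Eliminating wires and positions\<close>

definition wires :: "nat \<Rightarrow> 'q node set" where
  "wires l = Inr ` {..<l} \<times> UNIV"

lemma finite_wires [simp]: "finite (wires l)"
  by (simp add: wires_def)

lemma path_step_wires:
  "path_step (wires l) W v x = (\<Sum>k<l. \<Sum>b\<in>UNIV. W x (Inr k, b) * v (Inr k, b))"
proof -
  have "path_step (wires l) W v x = (\<Sum>t\<in>Inr ` {..<l}. \<Sum>b\<in>UNIV. W x (t, b) * v (t, b))"
    unfolding path_step_def wires_def by (simp add: sum.cartesian_product)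
  then show ?thesis by (simp add: sum.reindex)
qed

lemma path_step_wires_entrance:
  "path_step (wires l) (node_weight E) v (Inr k, b)
     = (case entry E k of Inl s \<Rightarrow> 0 | Inr j \<Rightarrow> if j < l then v (Inr j, b) else 0)"
proof -
  have "path_step (wires l) (node_weight E) v (Inr k, b)
      = (\<Sum>j<l. if entry E k = Inr j then v (Inr j, b) else 0)"
    unfolding path_step_wires by (intro sum.cong refl) (cases b; simp add: UNIV_bool)
  then show ?thesis by (cases "entry E k") auto
qed

text \<open>Wires are deterministic with weight 1, so the value is 0 or 1. The indicator of
  \<open>leads_to\<close> solves the system, which bounds the least solution from above; induction
  on \<open>leads_to\<close> bounds it from below. On cycles the least solution is 0.\<close>

lemma path_sum_wires:
  assumes t: "t \<notin> Inr ` {..<l}"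
  shows "path_sum (wires l) (node_weight E) (\<lambda>z. node_weight E z (t, b')) (Inr k, b)
       = of_bool (leads_to l (entry E) k t \<and> b = b')"
proof -
  let ?v = "path_sum (wires l) (node_weight E) (\<lambda>z. node_weight E z (t, b'))"
  define u :: "'a node \<Rightarrow> ennreal" where
    "u z = (case fst z of Inl s \<Rightarrow> 0 | Inr k \<Rightarrow> of_bool (leads_to l (entry E) k t \<and> snd z = b'))" for z
  have u: "node_weight E (Inr k, b) (t, b') + path_step (wires l) (node_weight E) u (Inr k, b)
      = of_bool (leads_to l (entry E) k t \<and> b = b')" for k b
    unfolding path_step_wires_entrance using t
    by (subst leads_to_iff) (auto simp: u_def split: sum.split)
  have le: "?v (Inr k, b) \<le> u (Inr k, b)" if "k < l" for k b
  proof (rule path_sum_least)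
    fix x assume "x \<in> (wires l :: 'a node set)"
    then obtain k b where x: "x = (Inr k, b)" by (auto simp: wires_def)
    show "node_weight E x (t, b') + path_step (wires l) (node_weight E) u x \<le> u x"
      unfolding x u by (simp add: u_def)
  qed (use that in \<open>auto simp: wires_def\<close>)
  have ge: "1 \<le> ?v (Inr k, b')" if "leads_to l (entry E) k t" for k
    using that
  proof (induction rule: leads_to.induct)
    case (stop k)
    show ?case
      by (subst path_sum_unfold) simp
  next
    case (step k j t)
    then show ?case
      by (subst path_sum_unfold) (simp add: path_step_wires_entrance add_increasing)
  qed
  have wire: "?v z = u z" if z: "z \<in> wires l" for z
  proof -
    obtain k b where kb: "z = (Inr k, b)" "k < l" using z by (auto simp: wires_def)
    have "u (Inr k, b) \<le> ?v (Inr k, b)"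
      using ge[of k] by (auto simp: u_def)
    with le[OF kb(2), of b] show ?thesis unfolding kb(1) by (rule antisym)
  qed
  have "?v (Inr k, b) = node_weight E (Inr k, b) (t, b') + path_step (wires l) (node_weight E) u (Inr k, b)"
    by (subst path_sum_unfold, intro arg_cong2[where f = "(+)"] refl path_step_cong)
      (simp only: wire)
  then show ?thesis by (simp only: u)
qed

text \<open>Only the first edge carries a probability and a reward, the wires after it keep weight
  and level. This recovers the transition probabilities in the definition of the trace.\<close>

lemma path_sum_wires_position:
  assumes E: "substochastic_mdp m n E" and s: "s \<in> positions E" and "l \<le> n"
    and t: "t \<in> targets E" "t \<notin> Inr ` {..<l}"
  shows "path_sum (wires l) (node_weight E) (\<lambda>z. node_weight E z (t, b')) (Inl s, b)
       = ennreal (tprob E s () t + (\<Sum>i\<in>prec l E t. tprob E s () (Inr i))) *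
         dual_coeff (reward E s) b b'"
proof -
  note D = substochastic_mdpD[OF E]
  let ?d = "dual_coeff (reward E s) b b'"
  have wire: "(\<Sum>c\<in>UNIV. node_weight E (Inl s, b) (Inr k, c) *
        path_sum (wires l) (node_weight E) (\<lambda>z. node_weight E z (t, b')) (Inr k, c))
      = (if leads_to l (entry E) k t then ennreal (tprob E s () (Inr k)) * ?d else 0)" for k
    by (cases b') (simp_all add: path_sum_wires[OF t(2)] UNIV_bool del: sum_mult_of_bool_eq)
  have "path_sum (wires l) (node_weight E) (\<lambda>z. node_weight E z (t, b')) (Inl s, b)
      = ennreal (tprob E s () t) * ?d
        + (\<Sum>k<l. if leads_to l (entry E) k t then ennreal (tprob E s () (Inr k)) * ?d else 0)"
    by (subst path_sum_unfold) (simp only: path_step_wires wire, simp only: node_weight_Inl)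
  also have "(\<Sum>k<l. if leads_to l (entry E) k t then ennreal (tprob E s () (Inr k)) * ?d else 0)
      = (\<Sum>k\<in>prec l E t. ennreal (tprob E s () (Inr k)) * ?d)"
    unfolding prec_def by (subst sum.inter_filter[symmetric]) (auto intro!: sum.cong)
  also have "\<dots> = ennreal (\<Sum>k\<in>prec l E t. tprob E s () (Inr k)) * ?d"
    unfolding sum_distrib_right[symmetric] using s \<open>l \<le> n\<close> D(2)
    by (subst sum_ennreal) (auto simp: prec_def intro!: D(5))
  finally show ?thesis
    using s t \<open>l \<le> n\<close> D(2)
    by (subst ennreal_plus) (auto simp: prec_def distrib_right intro!: D(5) sum_nonneg)
qed

text \<open>Admitting \<open>Inr k\<close> with \<open>k < l\<close> as an intermediate node
  identifies exit \<open>k\<close> with entrance \<open>k\<close>, which is the feedback itself.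
  Both sides are then reductions of one path sum over
  \<open>wires l \<union> nodes E\<close>.\<close>

lemma chain_sem_trace:
  fixes E :: "('q, unit) romdp"
  assumes "traceable l m n E" and i: "i < m" and j: "j < n"
  shows "chain_sem (romdp_trace l m n E) (Inr i, b) (Inr j, True)
       = path_sum (wires l) (chain_sem E) (\<lambda>x. chain_sem E x (Inr (l + j), True)) (Inr (l + i), b)"
proof -
  interpret traceable l m n E by fact
  let ?T = "romdp_trace l m n E"
  define W where "W = node_weight E"
  define V where "V x z = path_sum (wires l) W (\<lambda>y. W y z) x" for x z
  \<comment> \<open>It fixes all positions and matters only for the start, sending entrance
    \<open>l + i\<close> of \<open>E\<close> to entrance \<open>i\<close> of the traced
    chain.\<close>
  define f :: "'q node \<Rightarrow> 'q node" where "f = map_prod (map_sum id (\<lambda>t. t - l)) id"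
  have f [simp]: "f (Inl s, c) = (Inl s, c)" "f (Inr e, c) = (Inr (e - l), c)" for s e c
    by (simp_all add: f_def)
  have f_nodes: "f x = x" if "x \<in> nodes E" for x
    using that by (auto simp: nodes_def)
  have f_image: "f ` nodes E = nodes E"
    using f_nodes image_cong[OF refl, of "nodes E" f "\<lambda>x. x"] by simp
  have nodes: "nodes ?T = nodes E" by (simp add: nodes_def)
  have weight: "node_weight ?T (f x) (t, c) = V x (unshift l t, c)"
    if x: "x \<in> insert (Inr (l + i), b) (nodes E)" and t: "t \<in> targets ?T" for x t c
  proof (cases "x \<in> nodes E")
    case True
    then obtain s d where s: "x = (Inl s, d)" "s \<in> positions E" by (auto simp: nodes_def)
    have "unshift l t \<in> targets E" using t D(2) by (cases t) auto
    then show ?thesis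
      using path_sum_wires_position[OF substochastic s(2) _ _ unshift_not_wire, of l t c d]
      by (simp add: V_def W_def s)
  next
    case False
    then have x: "x = (Inr (i + l), b)" using x by (simp add: add.commute)
    show ?thesis
      unfolding x V_def W_def path_sum_wires[OF unshift_not_wire]
      using entry_trace_eq_iff[OF i] by simp
  qed
  have "chain_sem ?T (f (Inr (l + i), b)) (Inr j, True)
      = path_sum (nodes E) V (\<lambda>x. V x (Inr (l + j), True)) (Inr (l + i), b)"
    unfolding chain_sem_def
  proof (rule path_sum_embed)
    show "finite (nodes ?T)" using D(3) by (simp add: nodes finite_nodes)
    show "inj_on f (nodes E)" using f_nodes by (auto simp: inj_on_def)
    show "f ` nodes E \<subseteq> nodes ?T" using f_nodes nodes by auto
    show "node_weight ?T (f x) (f y) = V x y"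
      if x: "x \<in> insert (Inr (l + i), b) (nodes E)" and y: "y \<in> nodes E" for x y
    proof -
      obtain s c where "y = (Inl s, c)" "s \<in> positions E" using y by (auto simp: nodes_def)
      then show ?thesis using weight[OF x, of "Inl s" c] by simp
    qed
    show "node_weight ?T (f x) z = 0" if "z \<in> nodes ?T - f ` nodes E" for x z
      using that f_image nodes by simp
    show "node_weight ?T (f x) (Inr j, True) = V x (Inr (l + j), True)"
      if "x \<in> insert (Inr (l + i), b) (nodes E)" for x
      using weight[OF that, of "Inr j" True] j by (simp add: add.commute)
  qed
  also have "\<dots> = path_sum (wires l \<union> nodes E) W (\<lambda>y. W y (Inr (l + j), True)) (Inr (l + i), b)"
    unfolding V_def using D(3)
    by (subst path_sum_eliminate) (auto simp: finite_nodes wires_def nodes_def)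
  also have "\<dots> = path_sum (wires l) (chain_sem E) (\<lambda>x. chain_sem E x (Inr (l + j), True)) (Inr (l + i), b)"
    unfolding chain_sem_def[abs_def] W_def[symmetric] using D(3)
    by (subst Un_commute, subst path_sum_eliminate) (auto simp: finite_nodes wires_def nodes_def)
  finally show ?thesis by simp
qed

section \<open>Path sums as matrix series\<close>

lemma index_mult_mat_sum:
  assumes "A \<in> carrier_mat m k" "B \<in> carrier_mat k n" "i < m" "j < n"
  shows "(A * B) $$ (i, j) = (\<Sum>a<k. A $$ (i, a) * B $$ (a, j))"
  using assms by (simp add: scalar_prod_def lessThan_atLeast0)

text \<open>\<open>g\<close> translates matrix indices into nodes. Nonnegativity is part of the
  induction because \<open>ennreal\<close> is multiplicative on nonnegative reals; \<open>C\<close>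
  and \<open>c\<close> are generalised because \<open>^\<^sub>m\<close> adds its new factor on the
  right.\<close>

lemma mult_pow_mat_eq_funpow_path_step:
  fixes B C :: "real mat"
  assumes B: "B \<in> carrier_mat N N" and inj: "inj_on g {..<N}"
    and S: "\<And>a a'. a < N \<Longrightarrow> a' < N \<Longrightarrow> B $$ (a, a') \<ge> 0 \<and> ennreal (B $$ (a, a')) = S (g a) (g a')"
    and C: "C \<in> carrier_mat N n" and j: "j < n"
    and c: "\<And>a. a < N \<Longrightarrow> C $$ (a, j) \<ge> 0 \<and> ennreal (C $$ (a, j)) = c (g a)"
    and a: "a < N"
  shows "(B ^\<^sub>m d * C) $$ (a, j) \<ge> 0 \<and>
    ennreal ((B ^\<^sub>m d * C) $$ (a, j)) = (path_step (g ` {..<N}) S ^^ d) c (g a)"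
  using C c
proof (induction d arbitrary: C c)
  case 0
  then show ?case using a B by simp
next
  case (Suc d)
  have BC: "B * C \<in> carrier_mat N n" using B Suc.prems(1) by simp
  have entry: "(B * C) $$ (a, j) = (\<Sum>a'<N. B $$ (a, a') * C $$ (a', j))" if "a < N" for a
    by (rule index_mult_mat_sum[OF B Suc.prems(1) that j])
  have step: "(B * C) $$ (a, j) \<ge> 0 \<and>
      ennreal ((B * C) $$ (a, j)) = path_step (g ` {..<N}) S c (g a)" if "a < N" for a
  proof
    show "(B * C) $$ (a, j) \<ge> 0"
      unfolding entry[OF that] using that S Suc.prems(2) by (intro sum_nonneg mult_nonneg_nonneg) auto
    have "ennreal ((B * C) $$ (a, j)) = (\<Sum>a'<N. ennreal (B $$ (a, a') * C $$ (a', j)))"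
      unfolding entry[OF that] using that S Suc.prems(2)
      by (intro sum_ennreal[symmetric] mult_nonneg_nonneg) auto
    also have "\<dots> = (\<Sum>a'<N. S (g a) (g a') * c (g a'))"
      using that S Suc.prems(2) by (intro sum.cong refl) (simp add: ennreal_mult)
    also have "\<dots> = path_step (g ` {..<N}) S c (g a)"
      by (simp add: path_step_def sum.reindex[OF inj])
    finally show "ennreal ((B * C) $$ (a, j)) = path_step (g ` {..<N}) S c (g a)" .
  qed
  have "B ^\<^sub>m Suc d * C = B ^\<^sub>m d * (B * C)"
    using B Suc.prems(1) by (simp add: assoc_mult_mat[of _ N N _ N _ n] pow_carrier_mat)
  then show ?case
    using Suc.IH[OF BC step] by (simp add: funpow_swap1)
qed

text \<open>The row of the start \<open>x\<close> forms the separate matrix \<open>A\<close>. The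
  term 0 of the path sum is \<open>c x\<close>, and term \<open>Suc d\<close> is the entry of
  \<open>A B^d C\<close>. Finiteness of the path sum supplies summability of the real
  series.\<close>

lemma path_sum_eq_mat_series:
  fixes A B C :: "real mat"
  assumes A: "A \<in> carrier_mat m N" and B: "B \<in> carrier_mat N N" and C: "C \<in> carrier_mat N n"
    and inj: "inj_on g {..<N}" and i: "i < m" and j: "j < n"
    and Ax: "\<And>a. a < N \<Longrightarrow> A $$ (i, a) \<ge> 0 \<and> ennreal (A $$ (i, a)) = S x (g a)"
    and S: "\<And>a a'. a < N \<Longrightarrow> a' < N \<Longrightarrow> B $$ (a, a') \<ge> 0 \<and> ennreal (B $$ (a, a')) = S (g a) (g a')"
    and c: "\<And>a. a < N \<Longrightarrow> C $$ (a, j) \<ge> 0 \<and> ennreal (C $$ (a, j)) = c (g a)"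
    and fin: "path_sum (g ` {..<N}) S c x \<noteq> top_class.top"
  shows "enn2real (path_sum (g ` {..<N}) S c x)
       = enn2real (c x) + (\<Sum>d. (A * B ^\<^sub>m d * C) $$ (i, j))"
proof -
  let ?T = "path_step (g ` {..<N}) S"
  note BC = mult_pow_mat_eq_funpow_path_step[OF B inj S C j c]
  have entry: "(A * B ^\<^sub>m d * C) $$ (i, j) = (\<Sum>a<N. A $$ (i, a) * (B ^\<^sub>m d * C) $$ (a, j))" for d
  proof -
    have "A * B ^\<^sub>m d * C = A * (B ^\<^sub>m d * C)"
      using A B C by (simp add: assoc_mult_mat[of _ m N _ N _ n] pow_carrier_mat)
    then show ?thesis
      using index_mult_mat_sum[OF A mult_carrier_mat[OF pow_carrier_mat[OF B] C] i j] by simp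
  qed
  have nonneg: "(A * B ^\<^sub>m d * C) $$ (i, j) \<ge> 0" for d
    unfolding entry using Ax BC by (intro sum_nonneg mult_nonneg_nonneg) auto
  have eq: "?T ((?T ^^ d) c) x = ennreal ((A * B ^\<^sub>m d * C) $$ (i, j))" for d
  proof -
    have "ennreal ((A * B ^\<^sub>m d * C) $$ (i, j))
        = (\<Sum>a<N. ennreal (A $$ (i, a) * (B ^\<^sub>m d * C) $$ (a, j)))"
      unfolding entry using Ax BC by (intro sum_ennreal[symmetric] mult_nonneg_nonneg) auto
    also have "\<dots> = (\<Sum>a<N. S x (g a) * (?T ^^ d) c (g a))"
      using Ax BC by (intro sum.cong refl) (simp add: ennreal_mult)
    finally show ?thesis
      by (simp add: path_step_def[of _ _ _ x] sum.reindex[OF inj])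
  qed
  have sum_eq: "path_sum (g ` {..<N}) S c x = c x + (\<Sum>d. ennreal ((A * B ^\<^sub>m d * C) $$ (i, j)))"
    unfolding path_sum_Suc eq ..
  have c_fin: "c x \<noteq> top_class.top"
    and series_fin: "(\<Sum>d. ennreal ((A * B ^\<^sub>m d * C) $$ (i, j))) \<noteq> top_class.top"
    using fin unfolding sum_eq by auto
  have summ: "summable (\<lambda>d. (A * B ^\<^sub>m d * C) $$ (i, j))"
    using nonneg series_fin by (rule summable_suminf_not_top)
  have "(\<Sum>d. ennreal ((A * B ^\<^sub>m d * C) $$ (i, j))) = ennreal (\<Sum>d. (A * B ^\<^sub>m d * C) $$ (i, j))"
    using nonneg summ by (rule suminf_ennreal2)
  moreover have "(\<Sum>d. (A * B ^\<^sub>m d * C) $$ (i, j)) \<ge> 0"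
    using nonneg summ by (intro suminf_nonneg)
  ultimately show ?thesis
    unfolding sum_eq using c_fin series_fin by (simp add: enn2real_add)
qed

lemma mc_sem_trace:
  fixes E :: "('q, unit) romdp"
  assumes tr: "traceable l m n E"
  shows "mc_sem (romdp_trace l m n E) = mc_trace l m n (mc_sem E)"
proof -
  interpret traceable l m n E by fact
  define p where "p = mat (l + m) (l + n) (\<lambda>(i, j). enn2real (chain_sem E (Inr i, True) (Inr j, True)))"
  define r where "r = mat (l + m) (l + n) (\<lambda>(i, j). enn2real (chain_sem E (Inr i, False) (Inr j, True)))"
  have pr: "p $$ (i, j) = enn2real (chain_sem E (Inr i, True) (Inr j, True))"
    "r $$ (i, j) = enn2real (chain_sem E (Inr i, False) (Inr j, True))"
    if "i < l + m" "j < l + n" for i j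
    using that by (simp_all add: p_def r_def)
  have val: "ennreal (p $$ (i, j)) = chain_sem E (Inr i, True) (Inr j, True)"
    "ennreal (r $$ (i, j)) = chain_sem E (Inr i, False) (Inr j, True)"
    "p $$ (i, j) \<ge> 0" "r $$ (i, j) \<ge> 0" if "i < l + m" "j < l + n" for i j
    using chain_sem_finite[OF substochastic that] by (auto simp: pr[OF that] less_top)
  define Apart where "Apart M = mat m l (\<lambda>(i, k). M $$ (l + i, k))" for M :: "real mat"
  define Bpart where "Bpart M = mat l l (\<lambda>(k, k'). M $$ (k, k'))" for M :: "real mat"
  define Cpart where "Cpart M = mat l n (\<lambda>(k, j). M $$ (k, l + j))" for M :: "real mat"
  define A where "A = four_block_mat (Apart p) (Apart r) (0\<^sub>m 0 l) (0\<^sub>m 0 l)"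
  define B where "B = four_block_mat (Bpart p) (Bpart r) (0\<^sub>m l l) (Bpart p)"
  define C where "C = Cpart r @\<^sub>r Cpart p"
  have dims: "A \<in> carrier_mat m (l + l)" "B \<in> carrier_mat (l + l) (l + l)" "C \<in> carrier_mat (l + l) n"
    by (auto simp: A_def B_def C_def Apart_def Bpart_def Cpart_def append_rows_def)
  have dims_p: "Apart p \<in> carrier_mat m l" "Bpart p \<in> carrier_mat l l" "Cpart p \<in> carrier_mat l n"
    by (auto simp: Apart_def Bpart_def Cpart_def)
  let ?c = "\<lambda>j x. chain_sem E x (Inr (l + j), True)"
  \<comment> \<open>The series of the semantic trace is finite because it is the semantics of the
    traced chain, which is itself substochastic.\<close>
  have fin: "path_sum (wires l) (chain_sem E) (?c j) (Inr (l + i), b) \<noteq> top_class.top"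
    if "i < m" "j < n" for i j b
    using chain_sem_finite[OF substochastic_trace that, of b] chain_sem_trace[OF tr that, of b] by simp
  have prob: "enn2real (chain_sem (romdp_trace l m n E) (Inr i, True) (Inr j, True))
      = p $$ (l + i, l + j) + (\<Sum>d. (Apart p * Bpart p ^\<^sub>m d * Cpart p) $$ (i, j))"
    if ij: "i < m" "j < n" for i j
  proof -
    \<comment> \<open>A path from level \<open>True\<close> stays there, so \<open>l\<close>
      unknowns suffice for the probabilities.\<close>
    define g :: "nat \<Rightarrow> 'q node" where "g k = (Inr k, True)" for k
    have inj: "inj_on g {..<l}" by (auto simp: g_def inj_on_def)
    have "path_sum (wires l) (chain_sem E) (?c j) (id (Inr (l + i), True))
        = path_sum (g ` {..<l}) (chain_sem E) (?c j) (Inr (l + i), True)"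
      by (rule path_sum_embed)
        (auto simp: wires_def g_def chain_sem_True_False image_iff)
    then have red: "path_sum (g ` {..<l}) (chain_sem E) (?c j) (Inr (l + i), True)
        = chain_sem (romdp_trace l m n E) (Inr i, True) (Inr j, True)"
      using chain_sem_trace[OF tr ij, of True] by simp
    have "enn2real (path_sum (g ` {..<l}) (chain_sem E) (?c j) (Inr (l + i), True))
        = enn2real (?c j (Inr (l + i), True)) + (\<Sum>d. (Apart p * Bpart p ^\<^sub>m d * Cpart p) $$ (i, j))"
    proof (rule path_sum_eq_mat_series[OF dims_p inj ij])
      show "path_sum (g ` {..<l}) (chain_sem E) (?c j) (Inr (l + i), True) \<noteq> top_class.top"
        unfolding red by (rule chain_sem_finite[OF substochastic_trace ij])
    qed (use ij in \<open>auto simp: Apart_def Bpart_def Cpart_def g_def val\<close>)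
    then show ?thesis
      using ij by (simp add: red pr)
  qed
  have rew: "enn2real (chain_sem (romdp_trace l m n E) (Inr i, False) (Inr j, True))
      = r $$ (l + i, l + j) + (\<Sum>d. (A * B ^\<^sub>m d * C) $$ (i, j))"
    if ij: "i < m" "j < n" for i j
  proof -
    \<comment> \<open>The reward level comes first: this is the order in which
      \<open>chain_sem\<close> produces the blocks \<open>(A_p A_r)\<close>, the upper triangular
      \<open>B\<close>, and \<open>C_r\<close> above \<open>C_p\<close>.\<close>
    define g :: "nat \<Rightarrow> 'q node" where
      "g a = (if a < l then (Inr a, False) else (Inr (a - l), True))" for a
    have inj: "inj_on g {..<l + l}" by (auto simp: g_def inj_on_def split: if_splits)
    have "(Inr k, b) \<in> g ` {..<l + l}" if "k < l" for k b
      using that by (cases b) (force simp: g_def image_iff intro: bexI[of _ "k + l"] bexI[of _ k])+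
    then have img: "g ` {..<l + l} = wires l"
      by (auto simp: wires_def g_def)
    have "enn2real (path_sum (g ` {..<l + l}) (chain_sem E) (?c j) (Inr (l + i), False))
        = enn2real (?c j (Inr (l + i), False)) + (\<Sum>d. (A * B ^\<^sub>m d * C) $$ (i, j))"
    proof (rule path_sum_eq_mat_series[OF dims inj ij])
      show "path_sum (g ` {..<l + l}) (chain_sem E) (?c j) (Inr (l + i), False) \<noteq> top_class.top"
        unfolding img by (rule fin[OF ij])
    qed (use ij in \<open>auto simp: A_def B_def C_def append_rows_def Apart_def Bpart_def Cpart_def g_def val
          chain_sem_levels\<close>)
    then show ?thesis
      using ij chain_sem_trace[OF tr ij, of False] by (simp add: img pr)
  qed
  have "mc_trace l m n (p, r)
      = (mat m n (\<lambda>(i, j). p $$ (l + i, l + j) + (\<Sum>d. (Apart p * Bpart p ^\<^sub>m d * Cpart p) $$ (i, j))),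
         mat m n (\<lambda>(i, j). r $$ (l + i, l + j) + (\<Sum>d. (A * B ^\<^sub>m d * C) $$ (i, j))))"
    unfolding mc_trace_def Let_def A_def B_def C_def Apart_def Bpart_def Cpart_def by simp
  then show ?thesis
    unfolding mc_sem_eq[OF substochastic] mc_sem_eq[OF substochastic_trace] p_def[symmetric] r_def[symmetric]
    by (auto simp: prob rew intro!: eq_matI)
qed

section \<open>The functor\<close>

lemma is_romdp_traceable:
  assumes "is_romdp (l + m) (l + n) E"
  shows "traceable l m n E"
proof
  show E: "substochastic_mdp (l + m) (l + n) E"
    by (rule is_romdp_imp_substochastic[OF assms])
  fix i i' j
  assume i: "i < l + m" "i' < l + m" "entry E i = Inr j" "entry E i' = Inr j"
  have "j < outs E"
    using substochastic_mdpD(4)[OF E i(1)] i(3) by simp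
  then have "j \<in> reached_exits E (Inl i) \<inter> reached_exits E (Inl i')"
    using i by simp
  moreover have "Inl i \<in> {..<ins E} <+> positions E" "Inl i' \<in> {..<ins E} <+> positions E"
    using i substochastic_mdpD(1)[OF E] by auto
  ultimately show "i = i'"
    using assms unfolding is_romdp_def unique_access_def by blast
qed

section \<open>Schedulers of compound MDPs\<close>

lemma induced_chain_comp:
  "induced_chain (romdp_comp A B) \<tau>
     = romdp_comp (induced_chain A (\<tau> \<circ> Inl)) (induced_chain B (\<tau> \<circ> Inr))"
  by (auto simp: induced_chain_def romdp_comp_def fun_eq_iff split: sum.split)

lemma induced_chain_sum:
  "induced_chain (romdp_sum A B) \<tau>
     = romdp_sum (induced_chain A (\<tau> \<circ> Inl)) (induced_chain B (\<tau> \<circ> Inr))"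
  by (auto simp: induced_chain_def romdp_sum_def fun_eq_iff split: sum.split)

lemma induced_chain_trace:
  "induced_chain (romdp_trace l m n E) \<tau> = romdp_trace l m n (induced_chain E \<tau>)"
  by (auto simp: induced_chain_def romdp_trace_def prec_def fun_eq_iff split: sum.split)

lemma scheduler_pairs:
  "{h (f (\<tau> \<circ> Inl)) (g (\<tau> \<circ> Inr)) |\<tau> :: 'q + 'r \<Rightarrow> 'a. True}
     = {h x y |x y. x \<in> {f \<tau> |\<tau>. True} \<and> y \<in> {g \<tau> |\<tau>. True}}"
proof -
  have "h (f \<tau>\<^sub>1) (g \<tau>\<^sub>2) \<in> {h (f (\<tau> \<circ> Inl)) (g (\<tau> \<circ> Inr)) |\<tau> :: 'q + 'r \<Rightarrow> 'a. True}" for \<tau>\<^sub>1 \<tau>\<^sub>2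
    by (intro CollectI exI[of _ "case_sum \<tau>\<^sub>1 \<tau>\<^sub>2"]) (simp add: case_sum_o_inj)
  then show ?thesis by blast
qed

lemma romdp_sem_comp:
  assumes A: "substochastic_mdp m k A" and B: "substochastic_mdp k n B"
  shows "romdp_sem (romdp_comp A B) = seq sem_cat (romdp_sem A) (romdp_sem B)"
proof -
  have eq: "mc_sem (induced_chain (romdp_comp A B) \<tau>)
      = mc_comp (mc_sem (induced_chain A (\<tau> \<circ> Inl))) (mc_sem (induced_chain B (\<tau> \<circ> Inr)))" for \<tau>
    unfolding induced_chain_comp
    by (rule mc_sem_comp[OF substochastic_induced_chain[OF A] substochastic_induced_chain[OF B]])
  have "romdp_sem (romdp_comp A B) = {mc_comp (mc_sem (induced_chain A (\<tau> \<circ> Inl)))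
      (mc_sem (induced_chain B (\<tau> \<circ> Inr))) |\<tau>. True}"
    unfolding romdp_sem_def eq ..
  also have "\<dots> = {mc_comp f g |f g. f \<in> romdp_sem A \<and> g \<in> romdp_sem B}"
    unfolding romdp_sem_def by (rule scheduler_pairs)
  finally show ?thesis by (simp only: sem_cat_def tsm_structure.simps)
qed

lemma romdp_sem_sum:
  assumes A: "substochastic_mdp m n A" and B: "substochastic_mdp m' n' B"
  shows "romdp_sem (romdp_sum A B) = tensor sem_cat (romdp_sem A) (romdp_sem B)"
proof -
  have eq: "mc_sem (induced_chain (romdp_sum A B) \<tau>)
      = mc_sum (mc_sem (induced_chain A (\<tau> \<circ> Inl))) (mc_sem (induced_chain B (\<tau> \<circ> Inr)))" for \<tau>
    unfolding induced_chain_sum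
    by (rule mc_sem_sum[OF substochastic_induced_chain[OF A] substochastic_induced_chain[OF B]])
  have "romdp_sem (romdp_sum A B) = {mc_sum (mc_sem (induced_chain A (\<tau> \<circ> Inl)))
      (mc_sem (induced_chain B (\<tau> \<circ> Inr))) |\<tau>. True}"
    unfolding romdp_sem_def eq ..
  also have "\<dots> = {mc_sum f g |f g. f \<in> romdp_sem A \<and> g \<in> romdp_sem B}"
    unfolding romdp_sem_def by (rule scheduler_pairs)
  finally show ?thesis by (simp only: sem_cat_def tsm_structure.simps)
qed

lemma romdp_sem_trace:
  assumes E: "is_romdp (l + m) (l + n) E"
  shows "romdp_sem (romdp_trace l m n E) = trc sem_cat l m n (romdp_sem E)"
proof -
  have "traceable l m n (induced_chain E \<tau>)" for \<tau>
    using is_romdp_traceable[OF E] by (simp add: traceable_def substochastic_induced_chain)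
  then show ?thesis
    unfolding romdp_sem_def sem_cat_def by (auto simp: induced_chain_trace mc_sem_trace)
qed

section \<open>Passage to isomorphism classes\<close>

lemma sem_functor_iso_class:
  assumes "substochastic_mdp m n A"
  shows "sem_functor (iso_class A) = romdp_sem A"
proof -
  note D = substochastic_mdpD[OF assms]
  have "romdp_sem B = romdp_sem A" if "B \<in> iso_class A" for B
    using that D by (intro romdp_sem_iso) (auto simp: iso_class_def)
  then show ?thesis
    using iso_class_nonempty[OF D(3)] by (auto simp: sem_functor_def)
qed

lemma sem_functor_UN: "sem_functor (\<Union>x\<in>X. F x) = (\<Union>x\<in>X. sem_functor (F x))"
  by (auto simp: sem_functor_def)

lemma iso_class_is_romdp: "is_romdp m n A \<Longrightarrow> B \<in> iso_class A \<Longrightarrow> is_romdp m n B"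
  by (auto simp: iso_class_def intro: is_romdp_iso)

lemma iso_class_romdp_sem: "is_romdp m n A \<Longrightarrow> B \<in> iso_class A \<Longrightarrow> romdp_sem B = romdp_sem A"
  by (rule romdp_sem_iso) (auto simp: iso_class_def is_romdp_def)

lemma iso_class_is_romdp_nonempty: "is_romdp m n A \<Longrightarrow> iso_class A \<noteq> {}"
  by (auto simp: is_romdp_def intro!: iso_class_nonempty)

text \<open>Composition of classes is a union over all pairs of representatives. Each pair
  contributes the same set of arrows, and there is at least one pair.\<close>

lemma sem_functor_seq:
  assumes A: "is_romdp m k A" and B: "is_romdp k n B"
  shows "sem_functor (seq roMDP (iso_class A) (iso_class B))
       = seq sem_cat (sem_functor (iso_class A)) (sem_functor (iso_class B))"
proof -
  have sub: "substochastic_mdp m k A'" "substochastic_mdp k n B'"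
    if "A' \<in> iso_class A" "B' \<in> iso_class B" for A' B'
    using that A B by (auto intro: is_romdp_imp_substochastic iso_class_is_romdp)
  have "sem_functor (iso_class (romdp_comp A' B')) = seq sem_cat (romdp_sem A) (romdp_sem B)"
    if "A' \<in> iso_class A" "B' \<in> iso_class B" for A' B'
    using sem_functor_iso_class[OF substochastic_comp[OF sub[OF that]]] romdp_sem_comp[OF sub[OF that]]
      iso_class_romdp_sem[OF A that(1)] iso_class_romdp_sem[OF B that(2)] by simp
  then show ?thesis
    using iso_class_is_romdp_nonempty[OF A] iso_class_is_romdp_nonempty[OF B]
    by (simp add: roMDP_def sem_functor_UN sem_functor_iso_class[OF is_romdp_imp_substochastic[OF A]]
        sem_functor_iso_class[OF is_romdp_imp_substochastic[OF B]])
qed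

lemma sem_functor_tensor:
  assumes A: "is_romdp m n A" and B: "is_romdp m' n' B"
  shows "sem_functor (tensor roMDP (iso_class A) (iso_class B))
       = tensor sem_cat (sem_functor (iso_class A)) (sem_functor (iso_class B))"
proof -
  have sub: "substochastic_mdp m n A'" "substochastic_mdp m' n' B'"
    if "A' \<in> iso_class A" "B' \<in> iso_class B" for A' B'
    using that A B by (auto intro: is_romdp_imp_substochastic iso_class_is_romdp)
  have "sem_functor (iso_class (romdp_sum A' B')) = tensor sem_cat (romdp_sem A) (romdp_sem B)"
    if "A' \<in> iso_class A" "B' \<in> iso_class B" for A' B'
    using sem_functor_iso_class[OF substochastic_sum[OF sub[OF that]]] romdp_sem_sum[OF sub[OF that]]
      iso_class_romdp_sem[OF A that(1)] iso_class_romdp_sem[OF B that(2)] by simp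
  then show ?thesis
    using iso_class_is_romdp_nonempty[OF A] iso_class_is_romdp_nonempty[OF B]
    by (simp add: roMDP_def sem_functor_UN sem_functor_iso_class[OF is_romdp_imp_substochastic[OF A]]
        sem_functor_iso_class[OF is_romdp_imp_substochastic[OF B]])
qed

lemma sem_functor_trc:
  assumes E: "is_romdp (l + m) (l + n) E"
  shows "sem_functor (trc roMDP l m n (iso_class E)) = trc sem_cat l m n (sem_functor (iso_class E))"
proof -
  have "sem_functor (iso_class (romdp_trace l m n E')) = trc sem_cat l m n (romdp_sem E)"
    if "E' \<in> iso_class E" for E'
    using sem_functor_iso_class[OF traceable.substochastic_trace[OF is_romdp_traceable]]
      romdp_sem_trace iso_class_is_romdp[OF E that] iso_class_romdp_sem[OF E that] by metis
  then show ?thesis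
    using iso_class_is_romdp_nonempty[OF E]
    by (simp add: roMDP_def sem_functor_UN sem_functor_iso_class[OF is_romdp_imp_substochastic[OF E]])
qed

lemma romdp_sem_in_arrows:
  assumes "substochastic_mdp m n A"
  shows "romdp_sem A \<in> arrows sem_cat m n"
  using mc_sem_in_mc_arrows[OF substochastic_induced_chain[OF assms]]
  by (auto simp: sem_cat_def romdp_sem_def)

lemma sem_functor_traced_symmetric_monoidal:
  "traced_symmetric_monoidal_functor (roMDP :: (nat, 'a) romdp set tsm_structure) sem_cat sem_functor"
  unfolding traced_symmetric_monoidal_functor_def
proof (intro conjI allI ballI)
  have arrow: "\<exists>A :: (nat, 'a) romdp. f = iso_class A \<and> is_romdp m n A" if "f \<in> arrows roMDP m n" for f m n
    using that by (auto simp: roMDP_def)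
  show "sem_functor f \<in> arrows sem_cat m n" if f: "f \<in> arrows roMDP m n" for m n and f :: "(nat, 'a) romdp set"
    using arrow[OF f] sem_functor_iso_class romdp_sem_in_arrows is_romdp_imp_substochastic by metis
  show "sem_functor (ident (roMDP :: (nat, 'a) romdp set tsm_structure) n) = ident sem_cat n" for n
    by (simp add: roMDP_def sem_cat_def sem_functor_iso_class[OF substochastic_id] romdp_sem_id)
  show "sem_functor (symm (roMDP :: (nat, 'a) romdp set tsm_structure) m n) = symm sem_cat m n" for m n
    by (simp add: roMDP_def sem_cat_def sem_functor_iso_class[OF substochastic_swap] romdp_sem_swap)
  show "sem_functor (seq roMDP f g) = seq sem_cat (sem_functor f) (sem_functor g)"
    if f: "f \<in> arrows roMDP m k" and g: "g \<in> arrows roMDP k n" for m k n and f g :: "(nat, 'a) romdp set"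
    using arrow[OF f] arrow[OF g] sem_functor_seq by blast
  show "sem_functor (tensor roMDP f g) = tensor sem_cat (sem_functor f) (sem_functor g)"
    if f: "f \<in> arrows roMDP m n" and g: "g \<in> arrows roMDP m' n'"
    for m n m' n' and f g :: "(nat, 'a) romdp set"
    using arrow[OF f] arrow[OF g] sem_functor_tensor by blast
  show "sem_functor (trc roMDP l m n h) = trc sem_cat l m n (sem_functor h)"
    if h: "h \<in> arrows roMDP (l + m) (l + n)" for l m n and h :: "(nat, 'a) romdp set"
    using arrow[OF h] sem_functor_trc by blast
qed

theorem theorem5:
  shows "traced_symmetric_monoidal_functor roMDP sem_cat
           (sem_functor :: (nat, 'a::finite) romdp set \<Rightarrow> mc_arrow set) \<and>
    (\<forall>m n. \<forall>A :: ('q, 'a) romdp. is_romdp m n A \<longrightarrow> sem_functor (iso_class A) = romdp_sem A) \<and>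
    (\<forall>m n. \<forall>A :: ('q, 'a) romdp. \<forall>B :: ('r, 'a) romdp.
       is_romdp m n A \<and> is_romdp m n B \<and> romdp_iso A B \<longrightarrow> romdp_sem A = romdp_sem B) \<and>
    (\<forall>m k n. \<forall>A :: ('q, 'a) romdp. \<forall>B :: ('r, 'a) romdp.
       is_romdp m k A \<and> is_romdp k n B \<longrightarrow>
       romdp_sem (romdp_comp A B) = seq sem_cat (romdp_sem A) (romdp_sem B)) \<and>
    (\<forall>m n m' n'. \<forall>A :: ('q, 'a) romdp. \<forall>B :: ('r, 'a) romdp.
       is_romdp m n A \<and> is_romdp m' n' B \<longrightarrow>
       romdp_sem (romdp_sum A B) = tensor sem_cat (romdp_sem A) (romdp_sem B)) \<and>
    (\<forall>l m n. \<forall>E :: ('q, 'a) romdp.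
       is_romdp (l + m) (l + n) E \<longrightarrow>
       romdp_sem (romdp_trace l m n E) = trc sem_cat l m n (romdp_sem E))"
proof (intro conjI allI impI; (elim conjE)?)
  show "traced_symmetric_monoidal_functor roMDP sem_cat
      (sem_functor :: (nat, 'a) romdp set \<Rightarrow> mc_arrow set)"
    by (rule sem_functor_traced_symmetric_monoidal)
next
  fix m n and A :: "('q, 'a) romdp"
  assume "is_romdp m n A"
  then show "sem_functor (iso_class A) = romdp_sem A"
    by (rule sem_functor_iso_class[OF is_romdp_imp_substochastic])
next
  fix m n and A :: "('q, 'a) romdp" and B :: "('r, 'a) romdp"
  assume "is_romdp m n A" "romdp_iso A B"
  then show "romdp_sem A = romdp_sem B"
    using romdp_sem_iso[of A B] by (simp add: is_romdp_def)
next
  fix m k n and A :: "('q, 'a) romdp" and B :: "('r, 'a) romdp"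
  assume "is_romdp m k A" "is_romdp k n B"
  then show "romdp_sem (romdp_comp A B) = seq sem_cat (romdp_sem A) (romdp_sem B)"
    by (rule romdp_sem_comp[OF is_romdp_imp_substochastic is_romdp_imp_substochastic])
next
  fix m n m' n' and A :: "('q, 'a) romdp" and B :: "('r, 'a) romdp"
  assume "is_romdp m n A" "is_romdp m' n' B"
  then show "romdp_sem (romdp_sum A B) = tensor sem_cat (romdp_sem A) (romdp_sem B)"
    by (rule romdp_sem_sum[OF is_romdp_imp_substochastic is_romdp_imp_substochastic])
next
  fix l m n and E :: "('q, 'a) romdp"
  assume "is_romdp (l + m) (l + n) E"
  then show "romdp_sem (romdp_trace l m n E) = trc sem_cat l m n (romdp_sem E)"
    by (rule romdp_sem_trace)
qed

end
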